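(* Let $(\mathbf X_m,\mathbf y_m)$, $m=1,\dots,T$, with $\mathbf X_m\in\mathbb R^{n_m\times d}$, $\mathbf y_m\in\mathbb R^{n_m}$, be jointly realizable regression tasks, let $\mathbf w_\star$ be the minimum-norm joint solution, $R=\max_{m}\|\mathbf X_m\|$ and $\bar r=\frac1T\sum_{m=1}^T\operatorname{rank}(\mathbf X_m)$. Let $\tau$ be a random task ordering with replacement and let $\mathbf w_0,\dots,\mathbf w_k$ be the iterates of continual linear regression learned to convergence (equivalently, of the block Kaczmarz method). Then for every $k\ge 3$, $$\mathbb E_\tau[\mathcal L(\mathbf w_k)]\le\frac{\min\big(\sqrt{d-\bar r},\sqrt{T\bar r}\big)\,\|\mathbf w_\star\|^2R^2}{2e(k-1)},\qquad \mathbb E_\tau[F_\tau(k)]\le\frac{3\min\big(\sqrt{d-\bar r},\sqrt{T\bar r}\big)\,\|\mathbf w_\star\|^2R^2}{2(k-2)}.$$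
   Context: Notation: $\|\cdot\|$ is the Euclidean norm for vectors and the spectral norm for matrices; $\mathbf X^+$ is the Moore--Penrose pseudo-inverse. Joint realizability: the set $\mathcal W_\star=\{\mathbf w\in\mathbb R^d:\mathbf X_m\mathbf w=\mathbf y_m\ \forall m\in\{1,\dots,T\}\}$ is nonempty. $\mathbf w_\star=\operatorname{argmin}_{\mathbf w\in\mathcal W_\star}\|\mathbf w\|$. Random task ordering with replacement: $\tau(1),\dots,\tau(k)$ are i.i.d. uniform on $\{1,\dots,T\}$. Iterates: $\mathbf w_0=\mathbf 0$; at iteration $t$ the learner starts from $\mathbf w_{t-1}$ and minimizes the loss $\mathcal L_{\tau(t)}(\mathbf w)=\frac12\|\mathbf X_{\tau(t)}\mathbf w-\mathbf y_{\tau(t)}\|^2$ by gradient descent to convergence, yielding $\mathbf w_t$. Explicitly (block Kaczmarz update), $\mathbf w_t=\mathbf w_{t-1}-\mathbf X_{\tau(t)}^+(\mathbf X_{\tau(t)}\mathbf w_{t-1}-\mathbf y_{\tau(t)})$. Training loss: $\mathcal L(\mathbf w)=\frac1{2T}\sum_{m=1}^T\|\mathbf X_m\mathbf w-\mathbf y_m\|^2$. Forgetting: $F_\tau(k)=\frac1{2k}\sum_{t=1}^k\|\mathbf X_{\tau(t)}\mathbf w_k-\mathbf y_{\tau(t)}\|^2$. *)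

theory Defs
  imports
    "HOL-Probability.Probability"
    "Jordan_Normal_Form.Matrix"
    "Jordan_Normal_Form.DL_Rank"
begin

text \<open>
  The number of rows of a data matrix may vary from task to task, so vectors and matrices
  are carrier-based rather than indexed by finite types.
  A collection of \<open>T\<close> tasks is given by \<open>X\<close> and \<open>y\<close>, of which only the values at the indices
  \<open>1, \<dots>, T\<close> matter.
\<close>

definition vnorm :: "real vec \<Rightarrow> real" where
  "vnorm v = sqrt (scalar_prod v v)"

text \<open>
  The unit ball, rather than the unit sphere, keeps the set nonempty (and the supremum equal to 0)
  for matrices without columns.
\<close>

definition spectral_norm :: "real mat \<Rightarrow> real" where
  "spectral_norm A = (SUP v \<in> {v \<in> carrier_vec (dim_col A). vnorm v \<le> 1}. vnorm (A *\<^sub>v v))"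

definition is_pseudo_inverse :: "real mat \<Rightarrow> real mat \<Rightarrow> bool" where
  "is_pseudo_inverse A P \<longleftrightarrow>
     P \<in> carrier_mat (dim_col A) (dim_row A) \<and>
     A * P * A = A \<and>
     P * A * P = P \<and>
     transpose_mat (A * P) = A * P \<and>
     transpose_mat (P * A) = P * A"

definition pseudo_inverse :: "real mat \<Rightarrow> real mat" where
  "pseudo_inverse A = (THE P. is_pseudo_inverse A P)"

definition joint_solutions ::
    "nat \<Rightarrow> nat \<Rightarrow> (nat \<Rightarrow> real mat) \<Rightarrow> (nat \<Rightarrow> real vec) \<Rightarrow> real vec set" where
  "joint_solutions d T X y = {w \<in> carrier_vec d. \<forall>m\<in>{1..T}. X m *\<^sub>v w = y m}"

definition min_norm_solution ::
    "nat \<Rightarrow> nat \<Rightarrow> (nat \<Rightarrow> real mat) \<Rightarrow> (nat \<Rightarrow> real vec) \<Rightarrow> real vec" where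
  "min_norm_solution d T X y = arg_min_on vnorm (joint_solutions d T X y)"

definition data_radius :: "nat \<Rightarrow> (nat \<Rightarrow> real mat) \<Rightarrow> real" where
  "data_radius T X = Max ((\<lambda>m. spectral_norm (X m)) ` {1..T})"

text \<open>
  The first argument of \<^const>\<open>vec_space.rank\<close> is the dimension of the column vectors,
  i.e. the number of rows.
\<close>

definition avg_rank :: "nat \<Rightarrow> (nat \<Rightarrow> real mat) \<Rightarrow> real" where
  "avg_rank T X = (\<Sum>m = 1..T. real (vec_space.rank (dim_row (X m)) (X m))) / real T"

text \<open>
  Gradient descent on the squared loss of the task \<open>m = \<tau>(t + 1)\<close>, run to convergence from \<open>w\<close>,
  ends at the minimiser closest to \<open>w\<close>. This is the block Kaczmarz step
  \<open>w - X\<^sub>m\<^sup>+ (X\<^sub>m w - y\<^sub>m)\<close>.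
\<close>

primrec iterate ::
    "nat \<Rightarrow> (nat \<Rightarrow> real mat) \<Rightarrow> (nat \<Rightarrow> real vec) \<Rightarrow> (nat \<Rightarrow> nat) \<Rightarrow> nat \<Rightarrow> real vec" where
  "iterate d X y \<tau> 0 = 0\<^sub>v d"
| "iterate d X y \<tau> (Suc t) =
     (let w = iterate d X y \<tau> t; m = \<tau> (Suc t)
      in w - pseudo_inverse (X m) *\<^sub>v (X m *\<^sub>v w - y m))"

definition training_loss ::
    "nat \<Rightarrow> (nat \<Rightarrow> real mat) \<Rightarrow> (nat \<Rightarrow> real vec) \<Rightarrow> real vec \<Rightarrow> real" where
  "training_loss T X y w = (\<Sum>m = 1..T. (vnorm (X m *\<^sub>v w - y m))\<^sup>2) / (2 * real T)"

definition forgetting ::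
    "nat \<Rightarrow> (nat \<Rightarrow> real mat) \<Rightarrow> (nat \<Rightarrow> real vec) \<Rightarrow> (nat \<Rightarrow> nat) \<Rightarrow> nat \<Rightarrow> real" where
  "forgetting d X y \<tau> k =
     (\<Sum>t = 1..k. (vnorm (X (\<tau> t) *\<^sub>v iterate d X y \<tau> k - y (\<tau> t)))\<^sup>2) / (2 * real k)"

text \<open>
  The joint law of i.i.d. uniform \<open>\<tau>(1), \<dots>, \<tau>(k)\<close>; outside \<open>{1..k}\<close> the ordering takes
  the irrelevant default value 0.
\<close>

definition random_ordering :: "nat \<Rightarrow> nat \<Rightarrow> (nat \<Rightarrow> nat) pmf" where
  "random_ordering T k = Pi_pmf {1..k} 0 (\<lambda>_. pmf_of_set {1..T})"

end

theory Submission
  imports Defs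
begin

text \<open>
  Put \<open>E m = X m\<^sup>+ X m\<close>, \<open>P m = 1 - E m\<close> and let \<open>z\<close> be the error \<open>w - w\<^sub>\<star>\<close>; a step on task \<open>m\<close>
  replaces \<open>z\<close> by \<open>P m z\<close>. The expected squared error after \<open>n\<close> steps is the Frobenius product of
  \<open>z z\<^sup>T\<close> with \<open>Q\<^sup>n 1\<close>, where \<open>Q A\<close> is the mean of \<open>P m A P m\<close>. The map \<open>Q\<close> is self-adjoint with
  \<open>0 \<le> Q \<le> 1\<close>, hence \<open>Q\<^sup>n (1 - Q) \<le> 1 / (e n)\<close>, and the expected loss is at most
  \<open>R\<^sup>2 / 2\<close> times the decrement of the expected squared error. The factor \<open>\<surd>(d - r)\<close> is a bound on
  the Frobenius norm of \<open>Q 1\<close>; the factor \<open>\<surd>(T r)\<close> is one on the norm of the projection onto the sum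
  of the row spaces, which may replace \<open>1\<close> because \<open>1 - Q\<close> kills the difference.

  For the forgetting, the trajectory is compared with the one that skips step \<open>t\<close>. This costs
  a telescoping sum of decrements multiplied by the norm of the mean of the \<open>P m\<close>, which is at most
  \<open>min 1 (d - r)\<close> and so is absorbed by the rate even where that rate is below \<open>1\<close>.
\<close>

unbundle no vec_syntax
no_notation inner (infix "\<bullet>" 70)

section \<open>The pseudo-inverse and the rank\<close>

text \<open>Only dimension equations appear as hypotheses, so the simplifier can reassociate long
  products without being told the intermediate sizes.\<close>

lemma assoc_mult_mat_dim:
  fixes A B C :: "real mat"
  assumes "dim_col A = dim_row B" "dim_col B = dim_row C"
  shows "(A * B) * C = A * (B * C)"
  using assms by (intro assoc_mult_mat[of A "dim_row A" "dim_row B" B "dim_row C" C "dim_col C"]) auto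

lemma transpose_mult_dim:
  fixes A B :: "real mat"
  assumes "dim_col A = dim_row B"
  shows "(A * B)\<^sup>T = B\<^sup>T * A\<^sup>T"
  using assms by (intro transpose_mult[of A "dim_row A" "dim_row B" B "dim_col B"]) auto

lemma scalar_prod_self_nonneg: "0 \<le> v \<bullet> (v :: real vec)"
  by (auto simp: scalar_prod_def intro!: sum_nonneg)

lemma scalar_prod_self_eq_0: "v \<in> carrier_vec n \<Longrightarrow> v \<bullet> (v :: real vec) = 0 \<Longrightarrow> v = 0\<^sub>v n"
  by (intro eq_vecI) (auto simp: scalar_prod_def sum_nonneg_eq_0_iff)

definition mtrace :: "real mat \<Rightarrow> real" where
  "mtrace A = (\<Sum>i<dim_row A. A $$ (i, i))"

lemma mtrace_mult:
  assumes "A \<in> carrier_mat n m" "B \<in> carrier_mat m n"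
  shows "mtrace (A * B) = (\<Sum>i<n. \<Sum>j<m. A $$ (i, j) * B $$ (j, i))"
  using assms by (auto simp: mtrace_def scalar_prod_def atLeast0LessThan intro!: sum.cong)

lemma mtrace_comm:
  assumes "A \<in> carrier_mat n m" "B \<in> carrier_mat m n"
  shows "mtrace (A * B) = mtrace (B * A)"
  unfolding mtrace_mult[OF assms] mtrace_mult[OF assms(2,1)]
  by (subst sum.swap) (simp add: mult.commute)

lemma mtrace_one: "mtrace (1\<^sub>m n) = real n"
  by (simp add: mtrace_def)

text \<open>If B^T B x = 0 then |B x|^2 = x . B^T B x = 0, so x = 0 by injectivity; hence the Gram
  matrix has nonzero determinant.\<close>

lemma gram_inverse:
  fixes B :: "real mat"
  assumes B: "B \<in> carrier_mat n r"
    and inj: "\<And>x. x \<in> carrier_vec r \<Longrightarrow> B *\<^sub>v x = 0\<^sub>v n \<Longrightarrow> x = 0\<^sub>v r"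
  obtains G where "G \<in> carrier_mat r r" "G\<^sup>T = G" "G * (B\<^sup>T * B) = 1\<^sub>m r"
    "(B\<^sup>T * B) * G = 1\<^sub>m r"
proof -
  let ?M = "B\<^sup>T * B"
  have M: "?M \<in> carrier_mat r r" using B by auto
  have "det ?M \<noteq> 0"
  proof
    assume "det ?M = 0"
    then obtain x where x: "x \<in> carrier_vec r" "x \<noteq> 0\<^sub>v r" "?M *\<^sub>v x = 0\<^sub>v r"
      using det_0_iff_vec_prod_zero_field[OF M] by blast
    have "(B *\<^sub>v x) \<bullet> (B *\<^sub>v x) = (B\<^sup>T *\<^sub>v (B *\<^sub>v x)) \<bullet> x"
      using B x by (subst transpose_vec_mult_scalar[of B n r]) auto
    also have "\<dots> = 0" using B x by (subst assoc_mult_mat_vec[symmetric, of _ r n _ r]) auto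
    finally have "B *\<^sub>v x = 0\<^sub>v n"
      using B x by (intro scalar_prod_self_eq_0) auto
    with inj x show False by blast
  qed
  then have "?M \<in> Units (ring_mat TYPE(real) r ())"
    by (rule det_non_zero_imp_unit[OF M])
  then obtain G where G: "G \<in> carrier_mat r r" "G * ?M = 1\<^sub>m r" "?M * G = 1\<^sub>m r"
    by (auto simp: Units_def ring_mat_def)
  \<comment> \<open>Transposing \<open>?M * G = 1\<close> makes G^T a left inverse of the symmetric
    matrix \<open>?M\<close>; a left inverse and a right inverse coincide, so G is
    symmetric.\<close>
  have "(?M * G)\<^sup>T = G\<^sup>T * ?M\<^sup>T" using M G(1) by (rule transpose_mult)
  also have "?M\<^sup>T = ?M" by (simp add: transpose_mult_dim)
  finally have "(?M * G)\<^sup>T = G\<^sup>T * ?M" .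
  then have "G\<^sup>T * ?M = 1\<^sub>m r" unfolding G(3) by simp
  then have "G\<^sup>T = G\<^sup>T * ?M * G" using G M
    by (subst assoc_mult_mat[of _ r r _ r _ r]) (use G(1) in \<open>auto simp: G(3)\<close>)
  also have "\<dots> = G" using \<open>G\<^sup>T * ?M = 1\<^sub>m r\<close> G by simp
  finally show ?thesis using that G by blast
qed

lemma factor_through_columns:
  fixes A M :: "real mat"
  assumes A: "A \<in> carrier_mat n p" and M: "M \<in> carrier_mat n q"
    and ex: "\<And>j. j < q \<Longrightarrow> \<exists>c \<in> carrier_vec p. col M j = A *\<^sub>v c"
  obtains C where "C \<in> carrier_mat p q" "M = A * C"
proof -
  obtain c where c: "\<And>j. j < q \<Longrightarrow> c j \<in> carrier_vec p \<and> col M j = A *\<^sub>v c j"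
    using ex by metis
  define C where "C = mat_of_cols p (map c [0..<q])"
  have "C \<in> carrier_mat p q" by (auto simp: C_def mat_of_cols_def)
  moreover have "M = A * C"
  proof (rule mat_col_eqI)
    fix j assume "j < dim_col (A * C)"
    then have j: "j < q" by (simp add: C_def)
    have "col (A * C) j = A *\<^sub>v col C j" using j \<open>C \<in> _\<close> A by (intro col_mult2) auto
    moreover have "col C j = c j" unfolding C_def using j c by (subst col_mat_of_cols) auto
    ultimately show "col M j = col (A * C) j" using c[OF j] by simp
  qed (use A M \<open>C \<in> _\<close> in auto)
  ultimately show ?thesis using that by blast
qed

text \<open>The columns of B form a maximal independent set of columns of A. The columns of A lie in
  their span, which gives C; the columns of B are columns of A, so S merely selects them. S serves
  later to show that C has full row rank.\<close>

lemma full_rank_factorization: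
  fixes A :: "real mat"
  assumes A: "A \<in> carrier_mat n p"
  defines "r \<equiv> vec_space.rank n A"
  obtains B C S where "B \<in> carrier_mat n r" "C \<in> carrier_mat r p" "S \<in> carrier_mat p r"
    "A = B * C" "B = A * S"
    "\<And>x. x \<in> carrier_vec r \<Longrightarrow> B *\<^sub>v x = 0\<^sub>v n \<Longrightarrow> x = 0\<^sub>v r"
proof -
  interpret V: vec_space "TYPE(real)" n .
  have carr: "set (cols A) \<subseteq> carrier_vec n" using cols_dim A by blast
  obtain U where U: "maximal U (\<lambda>T. T \<subseteq> set (cols A) \<and> V.lin_indpt T)"
    using maximal_exists[of "(\<lambda>T. T \<subseteq> set (cols A) \<and> V.lin_indpt T)" "card (set (cols A))" "{}"]
    by (meson List.finite_set card_mono empty_iff empty_subsetI V.finite_lin_indpt2 rev_finite_subset)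
  then have sub: "U \<subseteq> set (cols A)" and ind: "V.lin_indpt U" by (auto simp: maximal_def)
  have fin: "finite U" using sub finite_subset by auto
  have Uc: "U \<subseteq> carrier_vec n" using sub carr by auto
  have cardU: "card U = r" using V.rank_card_indpt[OF A U] by (simp add: r_def)
  obtain us where us: "set us = U" "distinct us" using finite_distinct_list[OF fin] by blast
  have len: "length us = r" using us cardU distinct_card by force
  define B where "B = mat_of_cols n us"
  have B: "B \<in> carrier_mat n r" using len by (auto simp: B_def)
  have colsB: "cols B = us" unfolding B_def using us Uc by (intro cols_mat_of_cols) auto
  have inj: "x = 0\<^sub>v r" if "x \<in> carrier_vec r" "B *\<^sub>v x = 0\<^sub>v n" for x
    using V.lin_depI[OF B that(1) _ that(2)] ind us by (auto simp: colsB)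
  have span: "v \<in> V.span U" if v: "v \<in> set (cols A)" for v
  proof (rule ccontr)
    assume nv: "v \<notin> V.span U"
    then have "v \<notin> U" using Uc V.span_mem by auto
    then have "V.lin_indpt (U \<union> {v})"
      using V.lin_dep_iff_in_span[OF _ ind, of v] nv Uc v carr by auto
    then show False using U v \<open>v \<notin> U\<close> sub unfolding maximal_def by blast
  qed
  have exC: "\<exists>c \<in> carrier_vec r. col A j = B *\<^sub>v c" if "j < p" for j
  proof -
    have "col A j \<in> set (cols A)" using that A by (auto simp: cols_def)
    then have "col A j \<in> V.span U" by (rule span)
    then obtain a where a: "col A j = V.lincomb a U"
      using V.finite_span[OF fin] Uc by auto
    have "B *\<^sub>v (vec r (\<lambda>i. a (col B i))) = V.lincomb a (set (cols B))"
      using us by (intro V.mat_mult_eq_lincomb[OF B]) (simp add: colsB)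
    then show ?thesis using a us colsB by (intro bexI[of _ "vec r (\<lambda>i. a (col B i))"]) auto
  qed
  obtain C where C: "C \<in> carrier_mat r p" "A = B * C"
    using factor_through_columns[OF B A exC] by blast
  have exS: "\<exists>c \<in> carrier_vec p. col B j = A *\<^sub>v c" if "j < r" for j
  proof -
    have "col B j \<in> set (cols A)" using that B sub us colsB
      by (metis carrier_matD(2) cols_length cols_nth nth_mem subsetD)
    then obtain i where "i < p" "col B j = col A i" using A by (auto simp: cols_def)
    then show ?thesis using A by (intro bexI[of _ "unit_vec p i"]) (auto intro!: eq_vecI)
  qed
  obtain S where "S \<in> carrier_mat p r" "B = A * S"
    using factor_through_columns[OF A B exS] by blast
  with B C inj show ?thesis using that by blast
qed

text \<open>From A = B C of full rank the pseudo-inverse is C^T (C C^T)^-1 (B^T B)^-1 B^T. Then P A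
  = C^T (C C^T)^-1 C, whose trace is that of the r by r identity by cyclicity.\<close>

lemma pseudo_inverse_exists:
  fixes A :: "real mat"
  assumes A: "A \<in> carrier_mat n p"
  obtains P where "is_pseudo_inverse A P" "mtrace (P * A) = real (vec_space.rank n A)"
proof -
  define r where "r = vec_space.rank n A"
  obtain B C S where B: "B \<in> carrier_mat n r" and C: "C \<in> carrier_mat r p"
    and S: "S \<in> carrier_mat p r" and ABC: "A = B * C" and BAS: "B = A * S"
    and inj: "\<And>x. x \<in> carrier_vec r \<Longrightarrow> B *\<^sub>v x = 0\<^sub>v n \<Longrightarrow> x = 0\<^sub>v r"
    using full_rank_factorization[OF A] unfolding r_def by metis
  obtain G where G: "G \<in> carrier_mat r r" "G\<^sup>T = G" "G * (B\<^sup>T * B) = 1\<^sub>m r"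
    using gram_inverse[OF B inj] by blast
  have inj': "x = 0\<^sub>v r" if x: "x \<in> carrier_vec r" and 0: "C\<^sup>T *\<^sub>v x = 0\<^sub>v p" for x
  proof -
    \<comment> \<open>Here B = A S = B C S, and the left inverse G B^T of B cancels B: S is a right
      inverse of C, so C^T is injective.\<close>
    have "B * (C * S) = B" using B C S ABC BAS by (metis assoc_mult_mat)
    then have "G * (B\<^sup>T * (B * (C * S))) = G * (B\<^sup>T * B)" by simp
    then have "C * S = 1\<^sub>m r"
      using G B C S by (simp add: assoc_mult_mat[symmetric, of _ r n _ r _ r]
        assoc_mult_mat[symmetric, of _ r r _ r _ r])
    then have "S\<^sup>T * C\<^sup>T = 1\<^sub>m r" using C S by (metis transpose_mult transpose_one)
    then have "x = S\<^sup>T *\<^sub>v (C\<^sup>T *\<^sub>v x)"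
      using x C S by (subst assoc_mult_mat_vec[symmetric, of _ r p _ r]) auto
    then show ?thesis using 0 S by auto
  qed
  have C': "C\<^sup>T \<in> carrier_mat p r" using C by simp
  obtain H where H: "H \<in> carrier_mat r r" "H\<^sup>T = H" "H * (C * C\<^sup>T) = 1\<^sub>m r" "(C * C\<^sup>T) * H = 1\<^sub>m r"
    using gram_inverse[OF C' inj', unfolded transpose_transpose] by blast
  note dims = carrier_matD[OF B] carrier_matD[OF C] carrier_matD[OF G(1)] carrier_matD[OF H(1)]
  \<comment> \<open>The cancellation rules carry a trailing factor \<open>Z\<close> so that they
    fire inside products nested to the right.\<close>
  have GB: "G * (B\<^sup>T * (B * Z)) = Z" if "dim_row Z = r" for Z
  proof -
    have "G * (B\<^sup>T * (B * Z)) = (G * (B\<^sup>T * B)) * Z"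
      using that by (simp add: assoc_mult_mat_dim dims)
    then show ?thesis using G that by (auto intro: left_mult_one_mat[of Z r "dim_col Z"])
  qed
  have HC: "C * (C\<^sup>T * (H * Z)) = Z" if "dim_row Z = r" for Z
  proof -
    have "C * (C\<^sup>T * (H * Z)) = ((C * C\<^sup>T) * H) * Z"
      using that by (simp add: assoc_mult_mat_dim dims)
    then show ?thesis using H that by (auto intro: left_mult_one_mat[of Z r "dim_col Z"])
  qed
  define P where "P = C\<^sup>T * (H * (G * B\<^sup>T))"
  have AP: "A * P = B * (G * B\<^sup>T)"
    unfolding P_def ABC by (simp add: assoc_mult_mat_dim dims HC)
  have PA: "P * A = C\<^sup>T * (H * C)"
    unfolding P_def ABC by (simp add: assoc_mult_mat_dim dims GB)
  have "(B * (G * B\<^sup>T)) * (B * C) = B * C"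
    by (simp add: assoc_mult_mat_dim dims GB)
  then have "A * P * A = A"
    using AP ABC by metis
  moreover have "P * A * P = P"
    unfolding PA unfolding P_def by (simp add: assoc_mult_mat_dim dims HC)
  moreover have "(A * P)\<^sup>T = A * P"
    unfolding AP by (simp add: transpose_mult_dim assoc_mult_mat_dim dims G(2))
  moreover have "(P * A)\<^sup>T = P * A"
    unfolding PA by (simp add: transpose_mult_dim assoc_mult_mat_dim dims H(2))
  moreover have "P \<in> carrier_mat (dim_col A) (dim_row A)"
    using A B C G H by (auto simp: P_def)
  ultimately have "is_pseudo_inverse A P" by (simp add: is_pseudo_inverse_def)
  moreover have "mtrace (P * A) = r"
  proof -
    have "mtrace (P * A) = mtrace ((H * C) * C\<^sup>T)"
      unfolding PA using C H by (intro mtrace_comm[of _ p r]) auto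
    also have "(H * C) * C\<^sup>T = 1\<^sub>m r" using H dims by (simp add: assoc_mult_mat_dim)
    finally show ?thesis by (simp add: mtrace_one)
  qed
  ultimately show ?thesis using that by (simp add: r_def)
qed

text \<open>Symmetry gives A P = (A Q)(A P) = (A P A Q)^T = A Q and likewise P A = Q A; then P = P A
  P = Q A P = Q A Q = Q.\<close>

lemma is_pseudo_inverse_unique:
  assumes P: "is_pseudo_inverse A P" and Q: "is_pseudo_inverse A Q"
  shows "P = Q"
proof -
  have dims: "dim_row P = dim_col A" "dim_col P = dim_row A"
      "dim_row Q = dim_col A" "dim_col Q = dim_row A"
    and 1: "A * P * A = A" "P * A * P = P" "(A * P)\<^sup>T = A * P" "(P * A)\<^sup>T = P * A"
    and 2: "A * Q * A = A" "Q * A * Q = Q" "(A * Q)\<^sup>T = A * Q" "(Q * A)\<^sup>T = Q * A"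
    using P Q by (auto simp: is_pseudo_inverse_def)
  have "A * P = (A * Q * A) * P" by (simp add: 2)
  also have "\<dots> = (A * Q)\<^sup>T * (A * P)\<^sup>T" unfolding 1(3) 2(3) by (simp add: assoc_mult_mat_dim dims)
  also have "\<dots> = (A * P * A * Q)\<^sup>T"
    by (subst transpose_mult_dim[symmetric]) (simp_all add: assoc_mult_mat_dim dims)
  also have "\<dots> = A * Q" by (simp add: 1 2)
  finally have AP: "A * P = A * Q" .
  have "P * A = P * (A * Q * A)" by (simp add: 2)
  also have "\<dots> = (P * A)\<^sup>T * (Q * A)\<^sup>T" unfolding 1(4) 2(4) by (simp add: assoc_mult_mat_dim dims)
  also have "\<dots> = (Q * (A * P * A))\<^sup>T"
    by (subst transpose_mult_dim[symmetric]) (simp_all add: assoc_mult_mat_dim dims)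
  also have "\<dots> = Q * A" by (simp add: 1 2)
  finally have PA: "P * A = Q * A" .
  have "P = Q * A * P" using 1(2) PA by simp
  also have "\<dots> = Q * (A * P)" by (simp add: assoc_mult_mat_dim dims)
  also have "\<dots> = Q * A * Q" unfolding AP by (simp add: assoc_mult_mat_dim dims)
  finally show ?thesis by (simp add: 2)
qed

lemma pseudo_inverse:
  assumes "A \<in> carrier_mat n p"
  shows "is_pseudo_inverse A (pseudo_inverse A)"
    and "mtrace (pseudo_inverse A * A) = real (vec_space.rank n A)"
proof -
  obtain P where P: "is_pseudo_inverse A P" "mtrace (P * A) = real (vec_space.rank n A)"
    using pseudo_inverse_exists[OF assms] .
  then have "pseudo_inverse A = P"
    unfolding pseudo_inverse_def by (blast intro: is_pseudo_inverse_unique)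
  with P show "is_pseudo_inverse A (pseudo_inverse A)"
    and "mtrace (pseudo_inverse A * A) = real (vec_space.rank n A)" by simp_all
qed

section \<open>Orthogonal projections\<close>

text \<open>Cauchy-Schwarz row by row; the trace of A^T A is the squared Frobenius norm. For a
  projection this bounds |E v|^2 by trace times |v|^2, and it keeps the supremum in
  \<open>spectral_norm\<close> finite.\<close>

lemma norm_mult_mat_vec_le:
  fixes A :: "real mat"
  assumes A: "A \<in> carrier_mat n p" and v: "v \<in> carrier_vec p"
  shows "(A *\<^sub>v v) \<bullet> (A *\<^sub>v v) \<le> mtrace (A\<^sup>T * A) * (v \<bullet> v)"
proof -
  have "(A *\<^sub>v v) \<bullet> (A *\<^sub>v v) = (\<Sum>i<n. (\<Sum>j<p. A $$ (i, j) * v $ j)\<^sup>2)"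
    using A v by (auto simp: scalar_prod_def atLeast0LessThan power2_eq_square intro!: sum.cong)
  also have "\<dots> \<le> (\<Sum>i<n. (\<Sum>j<p. (A $$ (i, j))\<^sup>2) * (\<Sum>j<p. (v $ j)\<^sup>2))"
    by (intro sum_mono Cauchy_Schwarz_ineq_sum)
  also have "\<dots> = (\<Sum>j<p. \<Sum>i<n. (A $$ (i, j))\<^sup>2) * (\<Sum>j<p. (v $ j)\<^sup>2)"
    by (subst sum.swap) (simp add: sum_distrib_right)
  also have "(\<Sum>j<p. \<Sum>i<n. (A $$ (i, j))\<^sup>2) = mtrace (A\<^sup>T * A)"
    using A by (subst mtrace_mult[of _ p n]) (auto simp: power2_eq_square intro!: sum.cong)
  also have "(\<Sum>j<p. (v $ j)\<^sup>2) = v \<bullet> v"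
    using v by (auto simp: scalar_prod_def atLeast0LessThan power2_eq_square intro!: sum.cong)
  finally show ?thesis .
qed

lemma mtrace_gram_nonneg: "0 \<le> mtrace (A\<^sup>T * A)"
proof -
  have "mtrace (A\<^sup>T * A) = (\<Sum>i<dim_col A. \<Sum>j<dim_row A. (A\<^sup>T) $$ (i, j) * A $$ (j, i))"
    by (rule mtrace_mult) auto
  then show ?thesis by (auto intro!: sum_nonneg)
qed

lemma mtrace_add:
  assumes "A \<in> carrier_mat n n" "B \<in> carrier_mat n n"
  shows "mtrace (A + B) = mtrace A + mtrace B"
  using assms by (simp add: mtrace_def sum.distrib)

lemma mtrace_minus:
  assumes "A \<in> carrier_mat n n" "B \<in> carrier_mat n n"
  shows "mtrace (A - B) = mtrace A - mtrace B"
  using assms by (simp add: mtrace_def sum_subtractf)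

definition orth_proj :: "nat \<Rightarrow> real mat \<Rightarrow> bool" where
  "orth_proj d E \<longleftrightarrow> E \<in> carrier_mat d d \<and> E * E = E \<and> E\<^sup>T = E"

lemma orth_projD:
  assumes "orth_proj d E"
  shows "E \<in> carrier_mat d d" "E * E = E" "E\<^sup>T = E" "dim_row E = d" "dim_col E = d"
  using assms by (auto simp: orth_proj_def)

lemma orth_proj_pseudo_inverse:
  assumes "A \<in> carrier_mat n d"
  shows "orth_proj d (pseudo_inverse A * A)" and "A * (pseudo_inverse A * A) = A"
    and "orth_proj n (A * pseudo_inverse A)"
proof -
  note P = pseudo_inverse(1)[OF assms, unfolded is_pseudo_inverse_def]
  have dims: "dim_row A = n" "dim_col A = d" "dim_row (pseudo_inverse A) = d" "dim_col (pseudo_inverse A) = n"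
    using P assms by auto
  have 1: "A * (pseudo_inverse A * A) = A"
    using P by (subst assoc_mult_mat_dim[symmetric]) (auto simp: dims)
  then show "A * (pseudo_inverse A * A) = A" .
  show "orth_proj d (pseudo_inverse A * A)"
    unfolding orth_proj_def using P by (simp add: 1 assoc_mult_mat_dim dims carrier_matI)
  have 2: "pseudo_inverse A * (A * pseudo_inverse A) = pseudo_inverse A"
    using P by (subst assoc_mult_mat_dim[symmetric]) (auto simp: dims)
  show "orth_proj n (A * pseudo_inverse A)"
    unfolding orth_proj_def using P by (simp add: 2 assoc_mult_mat_dim dims carrier_matI)
qed

lemma orth_proj_scalar_prod:
  assumes E: "orth_proj d E" and u: "u \<in> carrier_vec d" and v: "v \<in> carrier_vec d"
  shows "(E *\<^sub>v u) \<bullet> (E *\<^sub>v v) = u \<bullet> (E *\<^sub>v v)"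
proof -
  note E' = orth_projD[OF E]
  have "(E\<^sup>T *\<^sub>v u) \<bullet> (E *\<^sub>v v) = u \<bullet> (E *\<^sub>v (E *\<^sub>v v))"
    using E' u v by (intro transpose_vec_mult_scalar[of _ d d]) auto
  also have "E *\<^sub>v (E *\<^sub>v v) = E *\<^sub>v v"
    using E' v by (subst assoc_mult_mat_vec[symmetric, of _ d d _ d]) auto
  finally show ?thesis by (simp add: E')
qed

lemma orth_proj_complement:
  assumes "orth_proj d E"
  shows "orth_proj d (1\<^sub>m d - E)"
proof -
  note E = orth_projD[OF assms]
  have "(1\<^sub>m d - E)\<^sup>T = 1\<^sub>m d - E"
    using E(1,3) by (metis one_carrier_mat transpose_minus transpose_one)
  moreover have "E * (1\<^sub>m d - E) = 0\<^sub>m d d"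
    using E by (subst mult_minus_distrib_mat[of _ d d _ d]) auto
  then have "(1\<^sub>m d - E) * (1\<^sub>m d - E) = 1\<^sub>m d - E"
    using E by (subst minus_mult_distrib_mat[of _ d d _ _ d]) auto
  ultimately show ?thesis using E by (auto simp: orth_proj_def)
qed

lemma complement_mult_vec:
  fixes E :: "real mat"
  assumes "E \<in> carrier_mat d d" "v \<in> carrier_vec d"
  shows "(1\<^sub>m d - E) *\<^sub>v v = v - E *\<^sub>v v"
  using assms by (subst minus_mult_distrib_mat_vec[of _ d d]) auto

lemma orth_proj_pythagoras:
  assumes E: "orth_proj d E" and v: "v \<in> carrier_vec d"
  shows "v \<bullet> v = (E *\<^sub>v v) \<bullet> (E *\<^sub>v v) + ((1\<^sub>m d - E) *\<^sub>v v) \<bullet> ((1\<^sub>m d - E) *\<^sub>v v)"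
proof -
  note E' = orth_projD[OF E] and P = orth_projD[OF orth_proj_complement[OF E]]
  have "v \<bullet> ((1\<^sub>m d - E) *\<^sub>v v) = v \<bullet> v - v \<bullet> (E *\<^sub>v v)"
    unfolding complement_mult_vec[OF E'(1) v]
    using E' v by (intro scalar_prod_minus_distrib[of _ d]) auto
  then show ?thesis
    using orth_proj_scalar_prod[OF E v v] orth_proj_scalar_prod[OF orth_proj_complement[OF E] v v] by simp
qed

lemma orth_proj_mtrace_nonneg: "orth_proj d E \<Longrightarrow> 0 \<le> mtrace E"
  using mtrace_gram_nonneg[of E] by (simp add: orth_proj_def)

lemma orth_proj_norm_le_mtrace:
  assumes "orth_proj d E" "v \<in> carrier_vec d"
  shows "(E *\<^sub>v v) \<bullet> (E *\<^sub>v v) \<le> mtrace E * (v \<bullet> v)"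
  using norm_mult_mat_vec_le[of E d d v] assms by (simp add: orth_proj_def)

lemma orth_proj_norm_le:
  assumes "orth_proj d E" "v \<in> carrier_vec d"
  shows "(E *\<^sub>v v) \<bullet> (E *\<^sub>v v) \<le> v \<bullet> v"
  using orth_proj_pythagoras[OF assms] scalar_prod_self_nonneg[of "(1\<^sub>m d - E) *\<^sub>v v"] by simp

section \<open>Joins of orthogonal projections\<close>

text \<open>\<open>G * E = G\<close> puts the range of G inside that of E, so E - G is again an
  orthogonal projection and has nonnegative trace.\<close>

lemma mtrace_proj_le:
  assumes E: "orth_proj d E" and G: "orth_proj d G" and GE: "G * E = G"
  shows "mtrace G \<le> mtrace E"
proof -
  note E' = orth_projD[OF E] and G' = orth_projD[OF G]
  have EG: "E * G = G"
    using GE E' G' by (metis transpose_mult)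
  have 1: "G * (E - G) = 0\<^sub>m d d"
    using E' G' by (subst mult_minus_distrib_mat[of _ d d _ d]) (auto simp: GE)
  have 2: "E * (E - G) = E - G"
    using E' G' by (subst mult_minus_distrib_mat[of _ d d _ d]) (auto simp: EG)
  have "(E - G) * (E - G) = E - G"
    using E' G' by (subst minus_mult_distrib_mat[of _ d d _ _ d]) (auto simp: 1 2)
  moreover have "(E - G)\<^sup>T = E - G" using E' G' by (metis transpose_minus)
  ultimately have "orth_proj d (E - G)" using E' G' by (auto simp: orth_proj_def)
  from orth_proj_mtrace_nonneg[OF this] show ?thesis
    using E' G' by (simp add: mtrace_minus)
qed

text \<open>F projects onto the sum of the two ranges. It is E1 + N, where N projects onto the range
  of A = (1 - E1) E2, which is orthogonal to that of E1. The trace of N = A A^+ is that of G = A^+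
  A, and G lies below E2 because A E2 = A.\<close>

lemma orth_proj_join_two:
  assumes E1: "orth_proj d E1" and E2: "orth_proj d E2"
  obtains F where "orth_proj d F" "E1 * F = E1" "E2 * F = E2"
    "mtrace F \<le> mtrace E1 + mtrace E2"
    "\<And>v. v \<in> carrier_vec d \<Longrightarrow> E1 *\<^sub>v v = 0\<^sub>v d \<Longrightarrow> E2 *\<^sub>v v = 0\<^sub>v d \<Longrightarrow> F *\<^sub>v v = 0\<^sub>v d"
proof -
  note E1' = orth_projD[OF E1] and E2' = orth_projD[OF E2]
  define A where "A = E2 - E1 * E2"
  define N where "N = A * pseudo_inverse A"
  define G where "G = pseudo_inverse A * A"
  have A: "A \<in> carrier_mat d d" using E1' E2' by (auto simp: A_def)
  have pA: "pseudo_inverse A \<in> carrier_mat d d"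
    using pseudo_inverse(1)[OF A] A by (auto simp: is_pseudo_inverse_def)
  have N: "orth_proj d N" and G: "orth_proj d G" and AG: "A * G = A"
    using orth_proj_pseudo_inverse[OF A] by (auto simp: N_def G_def)
  note N' = orth_projD[OF N]
  have NA: "N * A = A" using AG A pA by (simp add: N_def G_def assoc_mult_mat_dim)
  have "E1 * (E1 * E2) = E1 * E2"
    using E1' E2' by (subst assoc_mult_mat_dim[symmetric]) auto
  then have E1A: "E1 * A = 0\<^sub>m d d" unfolding A_def
    using E1' E2' by (subst mult_minus_distrib_mat[of _ d d _ d]) auto
  have E1N: "E1 * N = 0\<^sub>m d d" unfolding N_def
    using E1' A pA E1A by (subst assoc_mult_mat_dim[symmetric]) auto
  have NE1: "N * E1 = 0\<^sub>m d d"
    using E1N E1' N' by (metis transpose_mult zero_transpose_mat)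
  have "N * (E1 * E2) = 0\<^sub>m d d"
    using E1' E2' N' NE1 by (subst assoc_mult_mat_dim[symmetric]) auto
  then have "N * A = N * E2" unfolding A_def
    using E1' E2' N' by (subst mult_minus_distrib_mat[of _ d d _ d]) auto
  then have NE2: "N * E2 = A" using NA by simp
  define F where "F = E1 + N"
  have F: "F \<in> carrier_mat d d" using E1' N' by (auto simp: F_def)
  have FE1: "F * E1 = E1" unfolding F_def
    using E1'(1,2) N'(1) by (subst add_mult_distrib_mat[of _ d d _ _ d]) (auto simp: NE1)
  have "F * E2 = E1 * E2 + N * E2" unfolding F_def
    using E1'(1) N'(1) E2'(1) by (rule add_mult_distrib_mat)
  also have "\<dots> = E2" unfolding NE2 A_def
    using E1'(1) E2'(1) by (intro eq_matI) auto
  finally have FE2: "F * E2 = E2" .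
  have FN: "F * N = N" unfolding F_def
    using E1'(1) N'(1,2) by (subst add_mult_distrib_mat[of _ d d _ _ d]) (auto simp: E1N)
  have FT: "F\<^sup>T = F" unfolding F_def using E1' N' by (metis transpose_add)
  have "F * F = F * E1 + F * N" using F E1' N' unfolding F_def
    by (intro mult_add_distrib_mat[of _ d d _ d]) auto
  then have "F * F = F" unfolding FE1 FN by (simp add: F_def)
  then have "orth_proj d F" using F FT by (simp add: orth_proj_def)
  moreover have "E1 * F = E1" "E2 * F = E2"
    using FE1 FE2 F FT E1' E2' by (metis transpose_mult)+
  moreover have "mtrace F \<le> mtrace E1 + mtrace E2"
  proof -
    have "E1 * E2 * E2 = E1 * E2"
      using E1' E2' by (subst assoc_mult_mat_dim) auto
    then have "A * E2 = A" unfolding A_def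
      using E1' E2' by (subst minus_mult_distrib_mat[of _ d d _ _ d]) auto
    then have "G * E2 = G" unfolding G_def
      using A pA E2' by (subst assoc_mult_mat_dim) auto
    then have "mtrace G \<le> mtrace E2" by (rule mtrace_proj_le[OF E2 G])
    moreover have "mtrace N = mtrace G" unfolding N_def G_def using A pA by (rule mtrace_comm)
    ultimately show ?thesis unfolding F_def using E1' N' by (simp add: mtrace_add)
  qed
  moreover have "F *\<^sub>v v = 0\<^sub>v d"
    if v: "v \<in> carrier_vec d" "E1 *\<^sub>v v = 0\<^sub>v d" "E2 *\<^sub>v v = 0\<^sub>v d" for v
  proof -
    \<comment> \<open>By symmetry N = (A^+)^T A^T, and A^T = E2 - E2 E1 vanishes on the common
      kernel.\<close>
    have "N = (pseudo_inverse A)\<^sup>T * A\<^sup>T"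
      using N'(3) A pA unfolding N_def by (metis transpose_mult)
    moreover have "A\<^sup>T = E2 - E2 * E1"
      unfolding A_def using E1' E2' by (metis mult_carrier_mat transpose_minus transpose_mult)
    moreover have "((pseudo_inverse A)\<^sup>T * A\<^sup>T) *\<^sub>v v = (pseudo_inverse A)\<^sup>T *\<^sub>v (A\<^sup>T *\<^sub>v v)"
      using pA A v(1) by (intro assoc_mult_mat_vec[of _ d d _ d]) auto
    ultimately have "N *\<^sub>v v = (pseudo_inverse A)\<^sup>T *\<^sub>v ((E2 - E2 * E1) *\<^sub>v v)" by simp
    also have "(E2 - E2 * E1) *\<^sub>v v = E2 *\<^sub>v v - E2 *\<^sub>v (E1 *\<^sub>v v)"
      using E1' E2' v(1) by (subst minus_mult_distrib_mat_vec[of _ d d])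
        (auto simp: assoc_mult_mat_vec[of _ d d _ d])
    also have "\<dots> = 0\<^sub>v d" unfolding v(2,3) using E2' by auto
    finally have "N *\<^sub>v v = 0\<^sub>v d" using pA by auto
    then show ?thesis unfolding F_def
      using E1' N' v by (subst add_mult_distrib_mat_vec[of _ d d]) auto
  qed
  ultimately show ?thesis using that by blast
qed

lemma orth_proj_join:
  fixes T :: nat
  assumes "\<And>m. m \<in> {1..T} \<Longrightarrow> orth_proj d (E m)"
  obtains F where "orth_proj d F" "\<And>m. m \<in> {1..T} \<Longrightarrow> E m * F = E m"
    "mtrace F \<le> (\<Sum>m = 1..T. mtrace (E m))"
    "\<And>v. v \<in> carrier_vec d \<Longrightarrow> (\<And>m. m \<in> {1..T} \<Longrightarrow> E m *\<^sub>v v = 0\<^sub>v d) \<Longrightarrow> F *\<^sub>v v = 0\<^sub>v d"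
  using assms
proof (induction T arbitrary: thesis)
  case 0
  have "orth_proj d (0\<^sub>m d d)" by (simp add: orth_proj_def)
  moreover have "mtrace (0\<^sub>m d d) = 0" by (simp add: mtrace_def)
  ultimately show ?case by (intro 0(1)[of "0\<^sub>m d d"]) auto
next
  case (Suc T)
  obtain F where F: "orth_proj d F" "\<And>m. m \<in> {1..T} \<Longrightarrow> E m * F = E m"
    "mtrace F \<le> (\<Sum>m = 1..T. mtrace (E m))"
    "\<And>v. v \<in> carrier_vec d \<Longrightarrow> (\<And>m. m \<in> {1..T} \<Longrightarrow> E m *\<^sub>v v = 0\<^sub>v d) \<Longrightarrow> F *\<^sub>v v = 0\<^sub>v d"
    using Suc.IH Suc.prems(2) by (metis atLeastAtMost_iff le_SucI)
  have ES: "orth_proj d (E (Suc T))" by (rule Suc.prems(2)) simp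
  obtain H where H: "orth_proj d H" "F * H = F" "E (Suc T) * H = E (Suc T)"
    "mtrace H \<le> mtrace F + mtrace (E (Suc T))"
    "\<And>v. v \<in> carrier_vec d \<Longrightarrow> F *\<^sub>v v = 0\<^sub>v d \<Longrightarrow> E (Suc T) *\<^sub>v v = 0\<^sub>v d \<Longrightarrow> H *\<^sub>v v = 0\<^sub>v d"
    using orth_proj_join_two[OF F(1) ES] by metis
  show ?case
  proof (rule Suc.prems(1)[of H])
    fix m assume m: "m \<in> {1..Suc T}"
    show "E m * H = E m"
    proof (cases "m = Suc T")
      case False
      then have m': "m \<in> {1..T}" using m by auto
      note Em = orth_projD[OF Suc.prems(2)[OF m]] and F' = orth_projD[OF F(1)] and H' = orth_projD[OF H(1)]
      have "E m * H = (E m * F) * H" by (simp add: F(2)[OF m'])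
      also have "\<dots> = E m * (F * H)" using Em F' H' by (intro assoc_mult_mat_dim) auto
      finally show ?thesis by (simp add: F(2)[OF m'] H(2))
    qed (simp add: H)
  next
    show "mtrace H \<le> (\<Sum>m = 1..Suc T. mtrace (E m))" using F(3) H(4) by simp
  next
    fix v assume "v \<in> carrier_vec d" "\<And>m. m \<in> {1..Suc T} \<Longrightarrow> E m *\<^sub>v v = 0\<^sub>v d"
    then show "H *\<^sub>v v = 0\<^sub>v d" by (intro H(5) F(4)) auto
  qed (rule H)
qed

section \<open>Averaged compressions in the Frobenius inner product\<close>

definition mean :: "nat \<Rightarrow> (nat \<Rightarrow> real) \<Rightarrow> real" where
  "mean T f = (\<Sum>m = 1..T. f m) / real T"

lemma mean_cong: "(\<And>m. m \<in> {1..T} \<Longrightarrow> f m = g m) \<Longrightarrow> mean T f = mean T g"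
  by (simp add: mean_def)

lemma mean_mono: "(\<And>m. m \<in> {1..T} \<Longrightarrow> f m \<le> g m) \<Longrightarrow> mean T f \<le> mean T g"
  by (auto simp: mean_def intro!: divide_right_mono sum_mono)

lemma mean_linear: "mean T (\<lambda>m. a * f m + b * g m) = a * mean T f + b * mean T g"
  by (simp add: mean_def sum.distrib sum_distrib_left add_divide_distrib)

lemma mean_add: "mean T (\<lambda>m. f m + g m) = mean T f + mean T g"
  using mean_linear[of T 1 f 1 g] by simp

lemma mean_cmult: "mean T (\<lambda>m. a * f m) = a * mean T f"
  using mean_linear[of T a f 0 f] by simp

lemma mean_const: "T \<ge> 1 \<Longrightarrow> mean T (\<lambda>_. c) = c"
  by (simp add: mean_def)

lemma mean_sum: "mean T (\<lambda>m. \<Sum>i\<in>I. f i m) = (\<Sum>i\<in>I. mean T (f i))"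
  unfolding mean_def by (subst sum.swap) (simp add: sum_divide_distrib)

lemma mean_swap: "mean T (\<lambda>m. mean U (\<lambda>l. f m l)) = mean U (\<lambda>l. mean T (\<lambda>m. f m l))"
proof -
  have "(\<Sum>m = 1..T. \<Sum>l = 1..U. f m l) = (\<Sum>l = 1..U. \<Sum>m = 1..T. f m l)" by (rule sum.swap)
  then show ?thesis by (simp add: mean_def sum_divide_distrib[symmetric] mult.commute)
qed

definition frob :: "nat \<Rightarrow> real mat \<Rightarrow> real mat \<Rightarrow> real" where
  "frob d A B = (\<Sum>i<d. \<Sum>j<d. A $$ (i, j) * B $$ (i, j))"

lemma frob_comm: "frob d A B = frob d B A"
  by (simp add: frob_def mult.commute)

lemma frob_nonneg: "0 \<le> frob d A A"
  by (auto simp: frob_def intro!: sum_nonneg)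

lemma frob_eq_0: "frob d A A = 0 \<Longrightarrow> frob d A B = 0"
  by (simp add: frob_def sum_nonneg_eq_0_iff sum_nonneg)

lemma frob_two_le: "2 * frob d A B \<le> frob d A A + frob d B B"
proof -
  have "2 * (x * y) \<le> x * x + y * y" for x y :: real
    using sum_squares_bound[of x y] by (simp add: power2_eq_square)
  then have "(\<Sum>i<d. \<Sum>j<d. 2 * (A $$ (i, j) * B $$ (i, j)))
      \<le> (\<Sum>i<d. \<Sum>j<d. A $$ (i, j) * A $$ (i, j) + B $$ (i, j) * B $$ (i, j))"
    by (intro sum_mono)
  then show ?thesis by (simp add: frob_def sum.distrib sum_distrib_left)
qed

lemma frob_mtrace:
  assumes "A \<in> carrier_mat d d" "B \<in> carrier_mat d d"
  shows "frob d A B = mtrace (A\<^sup>T * B)"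
proof -
  have "mtrace (A\<^sup>T * B) = (\<Sum>j<d. \<Sum>i<d. A $$ (i, j) * B $$ (i, j))"
    using assms by (subst mtrace_mult[of _ d d]) auto
  also have "\<dots> = frob d A B"
    unfolding frob_def by (rule sum.swap)
  finally show ?thesis by simp
qed

text \<open>A named binary combination, so that \<open>frob\<close>, \<open>Q\<close> and the powers
  of \<open>Q\<close> need only one linearity rule each; a negative coefficient expresses a
  difference.\<close>

definition lincomb_mat :: "real \<Rightarrow> real mat \<Rightarrow> real \<Rightarrow> real mat \<Rightarrow> real mat" where
  "lincomb_mat a A b B = a \<cdot>\<^sub>m A + b \<cdot>\<^sub>m B"

lemma lincomb_mat_carrier [simp]:
  "A \<in> carrier_mat d d \<Longrightarrow> B \<in> carrier_mat d d \<Longrightarrow> lincomb_mat a A b B \<in> carrier_mat d d"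
  by (simp add: lincomb_mat_def)

lemma frob_lincomb_right:
  assumes "A \<in> carrier_mat d d" "B \<in> carrier_mat d d"
  shows "frob d C (lincomb_mat a A b B) = a * frob d C A + b * frob d C B"
proof -
  have "frob d C (lincomb_mat a A b B)
      = (\<Sum>i<d. \<Sum>j<d. a * (C $$ (i, j) * A $$ (i, j)) + b * (C $$ (i, j) * B $$ (i, j)))"
    unfolding frob_def using assms by (intro sum.cong) (auto simp: lincomb_mat_def ring_distribs)
  then show ?thesis by (simp add: frob_def sum.distrib sum_distrib_left)
qed

lemma frob_lincomb_left:
  assumes "A \<in> carrier_mat d d" "B \<in> carrier_mat d d"
  shows "frob d (lincomb_mat a A b B) C = a * frob d A C + b * frob d B C"
  using frob_lincomb_right[OF assms] by (simp add: frob_comm[of d _ C])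

section \<open>Decrements of moment sequences\<close>

text \<open>This is \<open>1 - (k + 1) x\<^sup>k + k x\<^sup>k\<^sup>+\<^sup>1 = (1 - x)\<^sup>2 (1 + 2 x + \<dots> + k x\<^sup>k\<^sup>-\<^sup>1)\<close>
  with the powers of \<open>x\<close> replaced by a sequence.\<close>

lemma convex_sequence_bound:
  fixes v :: "nat \<Rightarrow> real"
  assumes "\<And>j. 0 \<le> v j - 2 * v (Suc j) + v (Suc (Suc j))"
  shows "(real k + 1) * v k - real k * v (Suc k) \<le> v 0"
proof (induction k)
  case (Suc k)
  have "0 \<le> (real k + 1) * (v k - 2 * v (Suc k) + v (Suc (Suc k)))"
    using assms by (intro mult_nonneg_nonneg) auto
  with Suc show ?case by (simp add: algebra_simps)
qed simp

text \<open>Put x = 1 / (k + 1) in 1 - x \<le> exp (- x), invert, and raise to the power k +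
  1.\<close>

lemma exp_one_le_power:
  assumes "k \<ge> 1"
  shows "exp 1 \<le> (1 + 1 / real k) ^ Suc k"
proof -
  have "1 - 1 / real (Suc k) \<le> exp (- (1 / real (Suc k)))"
    using exp_ge_add_one_self[of "- (1 / real (Suc k))"] by simp
  then have "exp (1 / real (Suc k)) * (1 - 1 / real (Suc k)) \<le> 1"
    by (simp add: exp_minus field_simps)
  then have "exp (1 / real (Suc k)) \<le> 1 + 1 / real k"
    using assms by (simp add: field_simps)
  then have "exp (1 / real (Suc k)) ^ Suc k \<le> (1 + 1 / real k) ^ Suc k"
    by (intro power_mono) auto
  moreover have "exp (1 / real (Suc k)) ^ Suc k = exp 1"
    by (subst exp_of_nat_mult[symmetric]) simp
  ultimately show ?thesis by simp
qed

text \<open>The sequence u behaves like the moments of a positive measure on [0, 1]: the first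
  hypothesis says that x^j (1 - s x)^2 has nonnegative integral. The claim corresponds to x^k (1 -
  x) \<le> 1 / (e k), and this form needs no spectral decomposition.\<close>

lemma moment_decrement_bound:
  fixes u :: "nat \<Rightarrow> real"
  assumes conv: "\<And>s j. 0 \<le> u j - 2 * s * u (Suc j) + s\<^sup>2 * u (Suc (Suc j))"
    and dec: "u (Suc k) \<le> u k" and k: "k \<ge> 1"
  shows "u k - u (Suc k) \<le> u 0 / (exp 1 * real k)"
proof -
  \<comment> \<open>1 / s = k / (k + 1) is the point where x^k (1 - x) is largest on [0, 1].\<close>
  define s where "s = 1 + 1 / real k"
  have s: "s > 0" "real k * s = real k + 1" using k by (auto simp: s_def field_simps)
  \<comment> \<open>After multiplication by s^j the hypothesis is a second difference of s^j
    u_j.\<close>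
  have "0 \<le> s ^ j * (u j - 2 * s * u (Suc j) + s\<^sup>2 * u (Suc (Suc j)))" for j
    using s conv by (intro mult_nonneg_nonneg) auto
  then have "(real k + 1) * (s ^ k * u k) - real k * (s ^ Suc k * u (Suc k)) \<le> s ^ 0 * u 0"
    by (intro convex_sequence_bound[of "\<lambda>j. s ^ j * u j"]) (simp add: algebra_simps power2_eq_square)
  \<comment> \<open>As k s = k + 1, the two coefficients agree and a multiple of the decrement
    remains.\<close>
  also have "(real k + 1) * (s ^ k * u k) - real k * (s ^ Suc k * u (Suc k)) = real k * s ^ Suc k * (u k - u (Suc k))"
    unfolding s(2)[symmetric] by (simp add: algebra_simps)
  finally have 1: "real k * s ^ Suc k * (u k - u (Suc k)) \<le> u 0" by simp
  have "exp 1 * real k * (u k - u (Suc k)) \<le> real k * s ^ Suc k * (u k - u (Suc k))"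
    using exp_one_le_power[OF k] dec unfolding s_def
    by (intro mult_right_mono) (auto simp: mult.commute intro!: mult_left_mono)
  with 1 show ?thesis using k by (simp add: field_simps)
qed

section \<open>The averaged compression \<open>Q\<close>\<close>

locale orth_proj_family =
  fixes d T :: nat and E :: "nat \<Rightarrow> real mat"
  assumes T: "T \<ge> 1" and E: "\<And>m. m \<in> {1..T} \<Longrightarrow> orth_proj d (E m)"
begin

definition P :: "nat \<Rightarrow> real mat" where "P m = 1\<^sub>m d - E m"

lemma P: "m \<in> {1..T} \<Longrightarrow> orth_proj d (P m)"
  unfolding P_def by (intro orth_proj_complement E)

lemmas PD = orth_projD[OF P] and ED = orth_projD[OF E]

lemma P_vec [simp]: "m \<in> {1..T} \<Longrightarrow> x \<in> carrier_vec d \<Longrightarrow> P m *\<^sub>v x \<in> carrier_vec d"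
  by (rule mult_mat_vec_carrier[OF PD(1)])

lemma E_vec [simp]: "m \<in> {1..T} \<Longrightarrow> x \<in> carrier_vec d \<Longrightarrow> E m *\<^sub>v x \<in> carrier_vec d"
  by (rule mult_mat_vec_carrier[OF ED(1)])

lemma PAP_carrier [simp]: "m \<in> {1..T} \<Longrightarrow> A \<in> carrier_mat d d \<Longrightarrow> P m * A * P m \<in> carrier_mat d d"
  by (meson PD(1) mult_carrier_mat)

definition Q :: "real mat \<Rightarrow> real mat" where
  "Q A = mat d d (\<lambda>(i, j). mean T (\<lambda>m. (P m * A * P m) $$ (i, j)))"

lemma Q_carrier [simp]: "Q A \<in> carrier_mat d d"
  by (simp add: Q_def)

lemma Q_pow_carrier [simp]: "A \<in> carrier_mat d d \<Longrightarrow> (Q ^^ n) A \<in> carrier_mat d d"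
  by (cases n) auto

lemma frob_Q_left: "frob d (Q A) B = mean T (\<lambda>m. frob d (P m * A * P m) B)"
proof -
  have "frob d (Q A) B = (\<Sum>i<d. \<Sum>j<d. mean T (\<lambda>m. B $$ (i, j) * (P m * A * P m) $$ (i, j)))"
    unfolding frob_def mean_cmult by (intro sum.cong) (auto simp: Q_def)
  also have "\<dots> = mean T (\<lambda>m. \<Sum>i<d. \<Sum>j<d. B $$ (i, j) * (P m * A * P m) $$ (i, j))"
    by (simp only: mean_sum)
  finally show ?thesis by (simp only: frob_def mult.commute)
qed

text \<open>Symmetry of P and cyclicity of the trace: each compression is self-adjoint for the
  Frobenius product.\<close>

lemma frob_PAP:
  assumes m: "m \<in> {1..T}" and A: "A \<in> carrier_mat d d" and B: "B \<in> carrier_mat d d"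
  shows "frob d (P m * A * P m) B = frob d A (P m * B * P m)"
proof -
  note p = PD[OF m]
  have "frob d (P m * A * P m) B = mtrace ((P m * A\<^sup>T * P m) * B)"
    using p A B by (simp add: frob_mtrace transpose_mult_dim assoc_mult_mat_dim)
  also have "\<dots> = mtrace (P m * (A\<^sup>T * P m * B))"
    using p A B by (simp add: assoc_mult_mat_dim)
  also have "\<dots> = mtrace ((A\<^sup>T * P m * B) * P m)"
    using p A B by (intro mtrace_comm[of _ d d]) auto
  also have "\<dots> = frob d A (P m * B * P m)"
    using p A B by (simp add: frob_mtrace assoc_mult_mat_dim)
  finally show ?thesis .
qed

lemma PAP_idem:
  assumes m: "m \<in> {1..T}" and A: "A \<in> carrier_mat d d"
  shows "P m * (P m * A * P m) * P m = P m * A * P m"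
proof -
  note p = PD[OF m]
  have "P m * (P m * A * P m) * P m = (P m * P m) * A * (P m * P m)"
    using p(4,5) A by (simp add: assoc_mult_mat_dim)
  then show ?thesis by (simp add: p(2))
qed

text \<open>A compression is self-adjoint and idempotent, hence an orthogonal projection on matrix
  space. \<open>Q\<close> is thus a mean of orthogonal projections, from which its order properties
  follow.\<close>

lemma frob_PAP_self:
  assumes "m \<in> {1..T}" "A \<in> carrier_mat d d"
  shows "frob d (P m * A * P m) (P m * A * P m) = frob d A (P m * A * P m)"
  using frob_PAP[OF assms(1,2) PAP_carrier[OF assms]] by (simp add: PAP_idem[OF assms])

lemma frob_Q_right: "frob d A (Q B) = mean T (\<lambda>m. frob d A (P m * B * P m))"
  using frob_Q_left[of B A] by (simp add: frob_comm[of d A])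

lemma frob_Q:
  assumes "A \<in> carrier_mat d d" "B \<in> carrier_mat d d"
  shows "frob d (Q A) B = frob d A (Q B)"
  unfolding frob_Q_left frob_Q_right by (intro mean_cong frob_PAP assms)

lemma frob_Q_pow:
  assumes A: "A \<in> carrier_mat d d" and B: "B \<in> carrier_mat d d"
  shows "frob d ((Q ^^ n) A) B = frob d A ((Q ^^ n) B)"
  using B
proof (induction n arbitrary: B)
  case (Suc n)
  have "frob d (Q ((Q ^^ n) A)) B = frob d ((Q ^^ n) A) (Q B)"
    using A Suc.prems by (intro frob_Q) auto
  also have "\<dots> = frob d A ((Q ^^ n) (Q B))" by (rule Suc.IH) simp
  finally show ?case by (simp add: funpow_swap1)
qed simp

lemma frob_Q_nonneg: "A \<in> carrier_mat d d \<Longrightarrow> 0 \<le> frob d A (Q A)"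
  unfolding frob_Q_right using mean_mono[of T "\<lambda>_. 0" "\<lambda>m. frob d A (P m * A * P m)"]
  by (simp add: frob_PAP_self[symmetric] frob_nonneg mean_const[OF T])

text \<open>This is Q^2 \<le> Q. Expand one factor \<open>Q A\<close> as a mean, bound each product
  by half the sum of squares, and absorb half of the left side.\<close>

lemma frob_Q_Q_le:
  assumes "A \<in> carrier_mat d d"
  shows "frob d (Q A) (Q A) \<le> frob d A (Q A)"
proof -
  have "frob d (P m * A * P m) (Q A) \<le> 1/2 * frob d A (P m * A * P m) + 1/2 * frob d (Q A) (Q A)"
    if "m \<in> {1..T}" for m
    using frob_two_le[of d "P m * A * P m" "Q A"] frob_PAP_self[OF that assms] by simp
  then have "frob d (Q A) (Q A) \<le> mean T (\<lambda>m. 1/2 * frob d A (P m * A * P m) + 1/2 * frob d (Q A) (Q A))"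
    by (subst frob_Q_left) (rule mean_mono)
  also have "\<dots> = 1/2 * frob d A (Q A) + 1/2 * frob d (Q A) (Q A)"
    by (simp only: mean_linear mean_const[OF T] frob_Q_right[of A A])
  finally show ?thesis by simp
qed

lemma frob_Q_le:
  assumes "A \<in> carrier_mat d d"
  shows "frob d A (Q A) \<le> frob d A A"
proof -
  have "frob d A (P m * A * P m) \<le> frob d A A" if "m \<in> {1..T}" for m
    using frob_two_le[of d A "P m * A * P m"] frob_PAP_self[OF that assms] by simp
  then have "frob d A (Q A) \<le> mean T (\<lambda>m. frob d A A)"
    unfolding frob_Q_right by (rule mean_mono)
  then show ?thesis by (simp add: mean_const[OF T])
qed

lemma Q_lincomb:
  assumes A: "A \<in> carrier_mat d d" and B: "B \<in> carrier_mat d d"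
  shows "Q (lincomb_mat a A b B) = lincomb_mat a (Q A) b (Q B)"
proof (rule eq_matI)
  fix i j assume "i < dim_row (lincomb_mat a (Q A) b (Q B))" "j < dim_col (lincomb_mat a (Q A) b (Q B))"
  then have ij: "i < d" "j < d" by (auto simp: lincomb_mat_def Q_def)
  have "(P m * lincomb_mat a A b B * P m) $$ (i, j)
      = a * (P m * A * P m) $$ (i, j) + b * (P m * B * P m) $$ (i, j)" if m: "m \<in> {1..T}" for m
  proof -
    note p = PD[OF m]
    have "P m * lincomb_mat a A b B = a \<cdot>\<^sub>m (P m * A) + b \<cdot>\<^sub>m (P m * B)"
      unfolding lincomb_mat_def using p(1) A B
      by (simp add: mult_add_distrib_mat[of _ d d _ d] mult_smult_distrib[of _ d d _ d])
    also have "\<dots> * P m = a \<cdot>\<^sub>m (P m * A * P m) + b \<cdot>\<^sub>m (P m * B * P m)"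
      using p(1) A B by (simp add: add_mult_distrib_mat[of _ d d _ _ d] mult_smult_assoc_mat[of _ d d _ d])
    finally show ?thesis using p ij A B by simp
  qed
  then have "mean T (\<lambda>m. (P m * lincomb_mat a A b B * P m) $$ (i, j))
      = mean T (\<lambda>m. a * (P m * A * P m) $$ (i, j) + b * (P m * B * P m) $$ (i, j))"
    by (rule mean_cong)
  then show "Q (lincomb_mat a A b B) $$ (i, j) = lincomb_mat a (Q A) b (Q B) $$ (i, j)"
    using ij by (simp add: Q_def mean_linear lincomb_mat_def)
qed (auto simp: lincomb_mat_def Q_def)

lemma Q_pow_lincomb:
  assumes A: "A \<in> carrier_mat d d" and B: "B \<in> carrier_mat d d"
  shows "(Q ^^ n) (lincomb_mat a A b B) = lincomb_mat a ((Q ^^ n) A) b ((Q ^^ n) B)"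
  by (induction n) (simp_all add: Q_lincomb A B)

text \<open>Self-adjointness splits the power evenly between both arguments. Positivity and
  monotonicity in the exponent then reduce to 0 \<le> Q, Q \<le> 1 and Q^2 \<le> Q at the matrix Q^i
  A, without a square root of Q.\<close>

lemma frob_Q_pow_cases:
  assumes "A \<in> carrier_mat d d"
  shows "frob d A ((Q ^^ (2 * i)) A) = frob d ((Q ^^ i) A) ((Q ^^ i) A)"
    and "frob d A ((Q ^^ Suc (2 * i)) A) = frob d ((Q ^^ i) A) (Q ((Q ^^ i) A))"
    and "frob d A ((Q ^^ Suc (Suc (2 * i))) A) = frob d (Q ((Q ^^ i) A)) (Q ((Q ^^ i) A))"
proof -
  have 1: "frob d A ((Q ^^ (i + j)) A) = frob d ((Q ^^ i) A) ((Q ^^ j) A)" for i j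
    using frob_Q_pow[of A "(Q ^^ j) A" i] assms by (simp add: funpow_add)
  show "frob d A ((Q ^^ (2 * i)) A) = frob d ((Q ^^ i) A) ((Q ^^ i) A)"
    using 1[of i i] by (simp add: mult_2)
  show "frob d A ((Q ^^ Suc (2 * i)) A) = frob d ((Q ^^ i) A) (Q ((Q ^^ i) A))"
    using 1[of i "Suc i"] by (simp add: mult_2)
  show "frob d A ((Q ^^ Suc (Suc (2 * i))) A) = frob d (Q ((Q ^^ i) A)) (Q ((Q ^^ i) A))"
    using 1[of "Suc i" "Suc i"] by (simp add: mult_2)
qed

lemma frob_Q_pow_nonneg:
  assumes "A \<in> carrier_mat d d"
  shows "0 \<le> frob d A ((Q ^^ n) A)"
proof (cases "even n")
  case True
  then obtain i where "n = 2 * i" by (elim evenE)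
  then show ?thesis by (simp only: frob_Q_pow_cases(1)[OF assms] frob_nonneg)
next
  case False
  then obtain i where "n = Suc (2 * i)" by (elim oddE) auto
  then show ?thesis by (simp only: frob_Q_pow_cases(2)[OF assms] frob_Q_nonneg Q_pow_carrier assms)
qed

lemma frob_Q_pow_decreasing:
  assumes "A \<in> carrier_mat d d"
  shows "frob d A ((Q ^^ Suc n) A) \<le> frob d A ((Q ^^ n) A)"
proof (cases "even n")
  case True
  then obtain i where "n = 2 * i" by (elim evenE)
  then show ?thesis by (simp only: frob_Q_pow_cases(1,2)[OF assms] frob_Q_le Q_pow_carrier assms)
next
  case False
  then obtain i where "n = Suc (2 * i)" by (elim oddE) auto
  then show ?thesis by (simp only: frob_Q_pow_cases(2,3)[OF assms] frob_Q_Q_le Q_pow_carrier assms)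
qed

text \<open>Positivity of Q^n at A - s Q A, expanded by self-adjointness; this is the moment
  condition of \<open>moment_decrement_bound\<close>.\<close>

lemma frob_Q_pow_convex:
  assumes A: "A \<in> carrier_mat d d"
  shows "0 \<le> frob d A ((Q ^^ n) A) - 2 * s * frob d A ((Q ^^ Suc n) A) + s\<^sup>2 * frob d A ((Q ^^ Suc (Suc n)) A)"
proof -
  let ?C = "lincomb_mat 1 A (- s) (Q A)"
  have C: "?C \<in> carrier_mat d d" using A by simp
  have 1: "(Q ^^ n) (Q A) = Q ((Q ^^ n) A)" by (simp add: funpow_swap1)
  have "0 \<le> frob d ?C ((Q ^^ n) ?C)" using C by (rule frob_Q_pow_nonneg)
  also have "\<dots> = frob d A ((Q ^^ n) A) - 2 * s * frob d A ((Q ^^ Suc n) A) + s\<^sup>2 * frob d A ((Q ^^ Suc (Suc n)) A)"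
    using A by (simp add: Q_pow_lincomb frob_lincomb_left frob_lincomb_right 1 frob_Q algebra_simps power2_eq_square)
  finally show ?thesis .
qed

lemma frob_decrement_self:
  assumes "A \<in> carrier_mat d d" "n \<ge> 1"
  shows "frob d A ((Q ^^ n) A) - frob d A ((Q ^^ Suc n) A) \<le> frob d A A / (exp 1 * real n)"
  using moment_decrement_bound[of "\<lambda>j. frob d A ((Q ^^ j) A)" n, OF frob_Q_pow_convex frob_Q_pow_decreasing] assms
  by simp

text \<open>Cauchy-Schwarz for the symmetric positive semidefinite form w(A, B) = (A, Q^n (1 - Q)
  B), whose diagonal is bounded by \<open>frob_decrement_self\<close>.\<close>

lemma frob_decrement:
  assumes A: "A \<in> carrier_mat d d" and B: "B \<in> carrier_mat d d" and n: "n \<ge> 1"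
  shows "frob d A ((Q ^^ n) B) - frob d A ((Q ^^ Suc n) B)
    \<le> sqrt (frob d A A) * sqrt (frob d B B) / (exp 1 * real n)"
proof -
  define w where "w X Y = frob d X ((Q ^^ n) Y) - frob d X ((Q ^^ Suc n) Y)" for X Y
  have comm: "w A B = w B A"
    unfolding w_def using frob_Q_pow[OF A B] frob_comm by metis
  let ?a = "sqrt (frob d A A)" and ?b = "sqrt (frob d B B)" and ?c = "1 / (exp 1 * real n)"
  have sq: "?a * ?a = frob d A A" "?b * ?b = frob d B B" by (simp_all add: frob_nonneg)
  show ?thesis
  \<comment> \<open>The final division by \<open>?a * ?b\<close> needs both norms positive; a matrix
    of norm zero makes w vanish.\<close>
  proof (cases "?a = 0 \<or> ?b = 0")
    case True
    then have "w A B = 0"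
    proof
      assume "?a = 0"
      then show ?thesis by (simp add: w_def frob_eq_0)
    next
      assume "?b = 0"
      then show ?thesis unfolding comm by (simp add: w_def frob_eq_0)
    qed
    then show ?thesis by (simp add: w_def frob_nonneg)
  next
    case False
    then have pos: "?a > 0" "?b > 0"
      using frob_nonneg[of d A] frob_nonneg[of d B] by (simp_all add: order_less_le)
    have w_lincomb: "w (lincomb_mat p A q B) (lincomb_mat p A q B)
        = p * p * w A A + p * q * (w A B + w B A) + q * q * w B B" for p q
      unfolding w_def Q_pow_lincomb[OF A B]
      by (simp add: frob_lincomb_left frob_lincomb_right A B algebra_simps)
    \<comment> \<open>With the norms as crossed weights, both diagonal terms get the same bound
      \<open>?a * ?a * ?b * ?b * ?c\<close>.\<close>
    let ?C = "lincomb_mat ?b A (- ?a) B"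
    have "0 \<le> w ?C ?C"
      unfolding w_def using frob_Q_pow_decreasing[of ?C n] A B by simp
    also have "w ?C ?C = ?b * ?b * w A A - ?a * ?b * (w A B + w B A) + ?a * ?a * w B B"
      unfolding w_lincomb by (simp only: mult_minus_left mult_minus_right minus_minus
        mult.commute[of ?b ?a] add_uminus_conv_diff)
    also have "\<dots> \<le> ?b * ?b * (?a * ?a * ?c) - ?a * ?b * (2 * w A B) + ?a * ?a * (?b * ?b * ?c)"
      using frob_decrement_self[OF A n] frob_decrement_self[OF B n] unfolding comm sq
      by (intro add_mono diff_mono mult_left_mono) (auto simp: w_def frob_nonneg)
    finally have "(?a * ?b) * w A B \<le> (?a * ?b) * (?a * ?b * ?c)" by (simp add: algebra_simps)
    then have "w A B \<le> ?a * ?b * ?c" using mult_pos_pos[OF pos] by (rule mult_left_le_imp_le)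
    then show ?thesis by (simp add: w_def)
  qed
qed

end

section \<open>Expected squared error\<close>

abbreviation nsq :: "real vec \<Rightarrow> real" where "nsq x \<equiv> x \<bullet> x"

lemma nsq_minus_le:
  assumes "u \<in> carrier_vec d" "v \<in> carrier_vec d"
  shows "nsq (u - v) \<le> 2 * nsq u + 2 * nsq v"
proof -
  have "(x - y) * (x - y) \<le> 2 * (x * x) + 2 * (y * y)" for x y :: real
    using zero_le_square[of "x + y"] by (simp add: algebra_simps)
  then have "(\<Sum>i<d. (u $ i - v $ i) * (u $ i - v $ i)) \<le> (\<Sum>i<d. 2 * (u $ i * u $ i) + 2 * (v $ i * v $ i))"
    by (intro sum_mono)
  then show ?thesis
    using assms by (simp add: scalar_prod_def atLeast0LessThan sum.distrib sum_distrib_left)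
qed

text \<open>The matrix x x^T, which turns the quadratic form of B at x into a linear functional of
  B.\<close>

definition outer :: "nat \<Rightarrow> real vec \<Rightarrow> real mat" where
  "outer d x = mat d d (\<lambda>(i, j). x $ i * x $ j)"

lemma outer_carrier [simp]: "outer d x \<in> carrier_mat d d"
  by (simp add: outer_def)

lemma frob_outer:
  assumes "x \<in> carrier_vec d" "B \<in> carrier_mat d d"
  shows "frob d (outer d x) B = x \<bullet> (B *\<^sub>v x)"
proof -
  have "x \<bullet> (B *\<^sub>v x) = (\<Sum>i<d. x $ i * (\<Sum>j<d. B $$ (i, j) * x $ j))"
    using assms by (auto simp: scalar_prod_def atLeast0LessThan intro!: sum.cong)
  also have "\<dots> = (\<Sum>i<d. \<Sum>j<d. x $ i * x $ j * B $$ (i, j))"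
    by (simp only: sum_distrib_left mult_ac)
  also have "\<dots> = frob d (outer d x) B"
    unfolding frob_def outer_def by (intro sum.cong) auto
  finally show ?thesis by simp
qed

lemma frob_outer_self:
  assumes "x \<in> carrier_vec d"
  shows "frob d (outer d x) (outer d x) = (nsq x)\<^sup>2"
proof -
  have "nsq x = (\<Sum>i<d. x $ i * x $ i)"
    using assms by (simp add: scalar_prod_def atLeast0LessThan)
  then have "(nsq x)\<^sup>2 = (\<Sum>i<d. \<Sum>j<d. (x $ i * x $ i) * (x $ j * x $ j))"
    by (simp only: power2_eq_square sum_product)
  also have "\<dots> = frob d (outer d x) (outer d x)"
    unfolding frob_def outer_def by (intro sum.cong) auto
  finally show ?thesis by simp
qed

section \<open>The transfer operator and energy decrements\<close>

context orth_proj_family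
begin

text \<open>The transition operator of one random step, acting on functions:
  \<open>(S ^^ n) q x\<close> is the expected value of q after n independent uniform steps from
  x.\<close>

definition S :: "(real vec \<Rightarrow> real) \<Rightarrow> real vec \<Rightarrow> real" where
  "S q x = mean T (\<lambda>m. q (P m *\<^sub>v x))"

text \<open>Peels off the first step of the walk; \<open>funpow_swap1\<close> peels off the
  last.\<close>

lemma S_pow_Suc: "(S ^^ Suc n) q x = mean T (\<lambda>m. (S ^^ n) q (P m *\<^sub>v x))"
  using S_def[of "(S ^^ n) q" x] by simp

lemma S_pow_mono:
  assumes "\<And>y. y \<in> carrier_vec d \<Longrightarrow> q y \<le> r y" "x \<in> carrier_vec d"
  shows "(S ^^ n) q x \<le> (S ^^ n) r x"
  using assms(2)
  by (induction n arbitrary: x) (auto simp: S_pow_Suc assms(1) simp del: funpow.simps(2) intro!: mean_mono)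

lemma S_pow_cong:
  assumes "\<And>y. y \<in> carrier_vec d \<Longrightarrow> q y = r y" "x \<in> carrier_vec d"
  shows "(S ^^ n) q x = (S ^^ n) r x"
  using assms by (intro antisym S_pow_mono) auto

lemma S_pow_linear: "(S ^^ n) (\<lambda>x. a * q x + b * r x) = (\<lambda>x. a * (S ^^ n) q x + b * (S ^^ n) r x)"
proof (induction n)
  case (Suc n)
  show ?case by (rule ext) (simp only: S_pow_Suc Suc.IH mean_linear)
qed simp

lemma S_pow_mean: "(S ^^ n) (\<lambda>x. mean T (\<lambda>m. f m x)) = (\<lambda>x. mean T (\<lambda>m. (S ^^ n) (f m) x))"
proof (induction n)
  case (Suc n)
  show ?case by (rule ext) (simp only: S_pow_Suc Suc.IH, rule mean_swap)
qed simp

lemma S_pow_zero: "(S ^^ n) (\<lambda>_. 0) x = 0"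
  using S_pow_linear[of n 0 "\<lambda>_. 0" 0 "\<lambda>_. 0"] by simp

lemma S_pow_nonneg:
  assumes "\<And>y. y \<in> carrier_vec d \<Longrightarrow> 0 \<le> q y" "x \<in> carrier_vec d"
  shows "0 \<le> (S ^^ n) q x"
  using S_pow_mono[of "\<lambda>_. 0" q x n] assms by (simp add: S_pow_zero)

abbreviation energy :: "nat \<Rightarrow> real vec \<Rightarrow> real" where
  "energy n \<equiv> (S ^^ n) (\<lambda>x. nsq x)"

definition defect :: "real vec \<Rightarrow> real" where
  "defect x = mean T (\<lambda>m. nsq (E m *\<^sub>v x))"

text \<open>Pythagoras for each pair \<open>E m\<close>, \<open>P m\<close>, averaged: the defect is
  the squared norm expected to be lost in the next step.\<close>

lemma defect_eq:
  assumes "x \<in> carrier_vec d"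
  shows "defect x = nsq x - S (\<lambda>x. nsq x) x"
proof -
  have "mean T (\<lambda>m. nsq x) = mean T (\<lambda>m. nsq (E m *\<^sub>v x) + nsq (P m *\<^sub>v x))"
    by (intro mean_cong) (simp add: P_def orth_proj_pythagoras[OF E assms])
  then show ?thesis by (simp add: mean_add mean_const[OF T] defect_def S_def)
qed

lemma S_pow_defect:
  assumes "x \<in> carrier_vec d"
  shows "(S ^^ n) defect x = energy n x - energy (Suc n) x"
proof -
  have "(S ^^ n) defect x = (S ^^ n) (\<lambda>x. 1 * nsq x + (-1) * S (\<lambda>x. nsq x) x) x"
    using assms by (intro S_pow_cong) (auto simp: defect_eq)
  also have "\<dots> = energy n x - (S ^^ n) (S (\<lambda>x. nsq x)) x"
    by (simp only: S_pow_linear)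
  finally show ?thesis by (simp add: funpow_swap1)
qed

lemma defect_nonneg: "0 \<le> defect x"
  unfolding defect_def using mean_mono[of T "\<lambda>_. 0" "\<lambda>m. nsq (E m *\<^sub>v x)"]
  by (simp add: mean_const[OF T] scalar_prod_self_nonneg)

lemma energy_nonneg: "x \<in> carrier_vec d \<Longrightarrow> 0 \<le> energy n x"
  by (rule S_pow_nonneg) (auto simp: scalar_prod_self_nonneg)

lemma energy_decreasing: "x \<in> carrier_vec d \<Longrightarrow> energy (Suc n) x \<le> energy n x"
  using S_pow_nonneg[of defect x n] S_pow_defect[of x n] defect_nonneg by simp

lemma energy_le: "x \<in> carrier_vec d \<Longrightarrow> energy n x \<le> nsq x"
proof (induction n)
  case (Suc n)
  then show ?case using energy_decreasing[of x n] by linarith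
qed simp

lemma frob_outer_PAP:
  assumes m: "m \<in> {1..T}" and B: "B \<in> carrier_mat d d" and x: "x \<in> carrier_vec d"
  shows "frob d (outer d x) (P m * B * P m) = frob d (outer d (P m *\<^sub>v x)) B"
proof -
  note p = PD[OF m]
  have "(P m * B * P m) *\<^sub>v x = P m *\<^sub>v (B *\<^sub>v (P m *\<^sub>v x))"
    using p(1) B x by (simp add: assoc_mult_mat_vec[of _ d d _ d])
  moreover have "((P m)\<^sup>T *\<^sub>v x) \<bullet> (B *\<^sub>v (P m *\<^sub>v x)) = x \<bullet> (P m *\<^sub>v (B *\<^sub>v (P m *\<^sub>v x)))"
    using p(1) B x by (intro transpose_vec_mult_scalar[of _ d d]) auto
  ultimately show ?thesis
    using m x B by (simp add: frob_outer p(3))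
qed

text \<open>On quadratic forms the walk acts through their matrices: a step replaces B by the mean
  of \<open>P m * B * P m\<close>. The energy is thereby governed by the powers of \<open>Q\<close>
  at the identity.\<close>

lemma S_pow_frob_outer:
  assumes B: "B \<in> carrier_mat d d" and x: "x \<in> carrier_vec d"
  shows "(S ^^ n) (\<lambda>x. frob d (outer d x) B) x = frob d (outer d x) ((Q ^^ n) B)"
  using x
proof (induction n arbitrary: x)
  case (Suc n)
  then have "(S ^^ Suc n) (\<lambda>x. frob d (outer d x) B) x
      = mean T (\<lambda>m. frob d (outer d x) (P m * (Q ^^ n) B * P m))"
    unfolding S_pow_Suc using B by (intro mean_cong) (auto simp: frob_outer_PAP)
  then show ?case by (simp add: frob_Q_right)
qed simp

lemma energy_eq_frob:
  assumes x: "x \<in> carrier_vec d"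
  shows "energy n x = frob d (outer d x) ((Q ^^ n) (1\<^sub>m d))"
proof -
  have "energy n x = (S ^^ n) (\<lambda>x. frob d (outer d x) (1\<^sub>m d)) x"
    using x by (intro S_pow_cong) (auto simp: frob_outer)
  then show ?thesis using x by (simp add: S_pow_frob_outer)
qed

lemma frob_decrement_outer:
  assumes "x \<in> carrier_vec d" "B \<in> carrier_mat d d" "n \<ge> 1" "frob d B B \<le> c"
  shows "frob d (outer d x) ((Q ^^ n) B) - frob d (outer d x) ((Q ^^ Suc n) B)
    \<le> nsq x * sqrt c / (exp 1 * real n)"
proof -
  have "sqrt (frob d (outer d x) (outer d x)) = nsq x"
    using assms by (simp add: frob_outer_self scalar_prod_self_nonneg)
  moreover have "nsq x * sqrt (frob d B B) / (exp 1 * real n) \<le> nsq x * sqrt c / (exp 1 * real n)"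
    using assms by (intro divide_right_mono mult_left_mono) (auto simp: scalar_prod_self_nonneg)
  ultimately show ?thesis
    using frob_decrement[OF outer_carrier assms(2,3), of x] by simp
qed

text \<open>The mean dimension of the kernels of the \<open>E m\<close>; for regression tasks it is
  d minus the average rank.\<close>

definition \<delta> :: real where "\<delta> = mean T (\<lambda>m. mtrace (P m))"

lemma delta_nonneg: "0 \<le> \<delta>"
  unfolding \<delta>_def using mean_mono[of T "\<lambda>_. 0" "\<lambda>m. mtrace (P m)"]
  by (simp add: mean_const[OF T] orth_proj_mtrace_nonneg[OF P])

lemma frob_Q_one_le: "frob d (Q (1\<^sub>m d)) (Q (1\<^sub>m d)) \<le> \<delta>"
proof -
  have "frob d (1\<^sub>m d) (P m * 1\<^sub>m d * P m) = mtrace (P m)" if m: "m \<in> {1..T}" for m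
    using PD(1,2)[OF m] by (simp add: frob_mtrace)
  then have "frob d (1\<^sub>m d) (Q (1\<^sub>m d)) = \<delta>"
    unfolding frob_Q_right \<delta>_def by (rule mean_cong)
  then show ?thesis using frob_Q_Q_le[of "1\<^sub>m d"] by simp
qed

text \<open>One power of \<open>Q\<close> is spent on replacing the identity, of Frobenius norm
  \<surd>d, by \<open>Q (1\<^sub>m d)\<close>, of norm at most \<surd>\<delta>. This leaves n - 1 in
  the denominator.\<close>

lemma energy_decrement_delta:
  assumes x: "x \<in> carrier_vec d" and n: "n \<ge> 2"
  shows "energy n x - energy (Suc n) x \<le> nsq x * sqrt \<delta> / (exp 1 * (real n - 1))"
proof -
  obtain k where k: "n = Suc k" "k \<ge> 1" using n by (cases n) auto
  have "(Q ^^ n) (1\<^sub>m d) = (Q ^^ k) (Q (1\<^sub>m d))" "(Q ^^ Suc n) (1\<^sub>m d) = (Q ^^ Suc k) (Q (1\<^sub>m d))"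
    by (simp_all add: k funpow_swap1)
  then show ?thesis
    using frob_decrement_outer[OF x Q_carrier k(2) frob_Q_one_le] unfolding energy_eq_frob[OF x]
    by (simp add: k)
qed

text \<open>On the common kernel of the \<open>E m\<close> every step is the identity, so the decrement only sees
  the projection \<open>F\<close> onto the sum of their ranges.\<close>

lemma energy_decrement_trace:
  assumes x: "x \<in> carrier_vec d" and n: "n \<ge> 1"
  shows "energy n x - energy (Suc n) x \<le> nsq x * sqrt (\<Sum>m = 1..T. mtrace (E m)) / (exp 1 * real n)"
proof -
  obtain F where F: "orth_proj d F" "\<And>m. m \<in> {1..T} \<Longrightarrow> E m * F = E m"
    "mtrace F \<le> (\<Sum>m = 1..T. mtrace (E m))"
    by (rule orth_proj_join[of T d E]) (use E in blast)+
  note F' = orth_projD[OF F(1)]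
  let ?K = "1\<^sub>m d - F"
  note K = orth_projD[OF orth_proj_complement[OF F(1)]]
  \<comment> \<open>Since E m F = E m, the matrix E m annihilates \<open>?K\<close>; hence P m fixes
    \<open>?K\<close> from the left and, by transposition, from the right.\<close>
  have "P m * ?K * P m = ?K" if m: "m \<in> {1..T}" for m
  proof -
    note p = PD[OF m] and e = ED[OF m]
    have "E m * ?K = 0\<^sub>m d d"
      using e(1) F'(1) by (subst mult_minus_distrib_mat[of _ d d _ d]) (auto simp: F(2)[OF m])
    moreover have "P m * ?K = 1\<^sub>m d * ?K - E m * ?K" unfolding P_def
      using one_carrier_mat e(1) K(1) by (rule minus_mult_distrib_mat)
    ultimately have PK: "P m * ?K = ?K"
      using K(4,5) by (simp only: left_mult_one_mat[OF K(1)]) (intro eq_matI, auto)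
    have "(P m * ?K)\<^sup>T = ?K\<^sup>T * (P m)\<^sup>T" using p(1) K(1) by (rule transpose_mult)
    then have "?K * P m = ?K" by (simp only: PK K(3) p(3))
    then show ?thesis by (simp add: PK)
  qed
  then have "mean T (\<lambda>m. (P m * ?K * P m) $$ (i, j)) = mean T (\<lambda>m. ?K $$ (i, j))" for i j
    by (intro mean_cong) simp
  then have QK: "Q ?K = ?K"
    unfolding Q_def mean_const[OF T] using F'(4,5) by (intro eq_matI) auto
  have QKn: "(Q ^^ j) ?K = ?K" for j by (induction j) (simp_all add: QK)
  have one: "1\<^sub>m d = lincomb_mat 1 F 1 ?K"
    using F' unfolding lincomb_mat_def by (intro eq_matI) auto
  \<comment> \<open>The contribution of \<open>?K\<close> is independent of j and cancels in the
    decrement.\<close>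
  have "energy j x = frob d (outer d x) ((Q ^^ j) F) + frob d (outer d x) ?K" for j
  proof -
    have "(Q ^^ j) (1\<^sub>m d) = lincomb_mat 1 ((Q ^^ j) F) 1 ?K"
      using Q_pow_lincomb[OF F'(1) K(1), of j 1 1] unfolding one[symmetric] QKn .
    then show ?thesis
      unfolding energy_eq_frob[OF x] using frob_lincomb_right[OF Q_pow_carrier[OF F'(1)] K(1)] by simp
  qed
  moreover have "frob d F F \<le> (\<Sum>m = 1..T. mtrace (E m))"
    using F F' by (simp add: frob_mtrace)
  ultimately show ?thesis
    using frob_decrement_outer[OF x F'(1) n] by (simp del: funpow.simps(2))
qed

definition rate :: real where
  "rate = min (sqrt \<delta>) (sqrt (\<Sum>m = 1..T. mtrace (E m)))"

lemma mtrace_sum_nonneg: "0 \<le> (\<Sum>m = 1..T. mtrace (E m))"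
  by (intro sum_nonneg orth_proj_mtrace_nonneg[OF E])

lemma rate_nonneg: "0 \<le> rate"
  using mtrace_sum_nonneg by (simp add: rate_def delta_nonneg)

lemma energy_decrement:
  assumes x: "x \<in> carrier_vec d" and n: "n \<ge> 2"
  shows "energy n x - energy (Suc n) x \<le> nsq x * rate / (exp 1 * (real n - 1))"
proof -
  let ?r = "sqrt (\<Sum>m = 1..T. mtrace (E m))"
  have "energy n x - energy (Suc n) x \<le> nsq x * ?r / (exp 1 * real n)"
    using x n by (intro energy_decrement_trace) auto
  also have "\<dots> \<le> nsq x * ?r / (exp 1 * (real n - 1))"
    using n by (intro divide_left_mono mult_left_mono mult_nonneg_nonneg mult_pos_pos)
      (use mtrace_sum_nonneg in \<open>auto simp: scalar_prod_self_nonneg\<close>)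
  finally show ?thesis
    using energy_decrement_delta[OF x n] by (simp add: rate_def min_def)
qed

text \<open>The first step already gives the factor \<delta>, by the trace bound for each
  \<open>P m\<close>; later steps do not increase the norm. The factor 1 is plain
  contraction.\<close>

lemma energy_Suc_le:
  assumes x: "x \<in> carrier_vec d"
  shows "energy (Suc n) x \<le> min 1 \<delta> * nsq x"
proof -
  have "energy (Suc n) x = mean T (\<lambda>m. energy n (P m *\<^sub>v x))" by (rule S_pow_Suc)
  also have "\<dots> \<le> mean T (\<lambda>m. nsq x * mtrace (P m))"
  proof (rule mean_mono)
    fix m assume m: "m \<in> {1..T}"
    show "energy n (P m *\<^sub>v x) \<le> nsq x * mtrace (P m)"
      using energy_le[OF P_vec[OF m x], of n] orth_proj_norm_le_mtrace[OF P[OF m] x]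
      by (simp add: mult.commute)
  qed
  also have "\<dots> = \<delta> * nsq x" by (simp add: mean_cmult \<delta>_def)
  finally show ?thesis using energy_le[OF x, of "Suc n"] by (metis min_def mult_1)
qed

section \<open>Residuals on a fixed task\<close>

text \<open>The task m stays fixed while the j further steps are random, as needed for a task that
  was seen earlier.\<close>

definition replay :: "nat \<Rightarrow> nat \<Rightarrow> real vec \<Rightarrow> real" where
  "replay m j = (S ^^ j) (\<lambda>x. nsq (E m *\<^sub>v x))"

text \<open>Every step is linear and the final functional is a squared seminorm, so |u - v|^2 \<le>
  2 |u|^2 + 2 |v|^2 passes through the averages.\<close>

lemma replay_minus_le:
  assumes m: "m \<in> {1..T}" and "x \<in> carrier_vec d" "y \<in> carrier_vec d"
  shows "replay m j (x - y) \<le> 2 * replay m j x + 2 * replay m j y"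
  using assms(2,3)
proof (induction j arbitrary: x y)
  case 0
  have "E m *\<^sub>v (x - y) = E m *\<^sub>v x - E m *\<^sub>v y"
    using ED(1)[OF m] 0 by (intro mult_minus_distrib_mat_vec[of _ d d])
  then show ?case using nsq_minus_le[of "E m *\<^sub>v x" d "E m *\<^sub>v y"] m 0 by (simp add: replay_def)
next
  case (Suc j)
  have eq: "replay m (Suc j) z = mean T (\<lambda>l. replay m j (P l *\<^sub>v z))" for z
    unfolding replay_def by (rule S_pow_Suc)
  have "P l *\<^sub>v (x - y) = P l *\<^sub>v x - P l *\<^sub>v y" if "l \<in> {1..T}" for l
    using PD(1)[OF that] Suc.prems by (intro mult_minus_distrib_mat_vec[of _ d d])
  then have "replay m (Suc j) (x - y)
      \<le> mean T (\<lambda>l. 2 * replay m j (P l *\<^sub>v x) + 2 * replay m j (P l *\<^sub>v y))"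
    unfolding eq using Suc by (intro mean_mono) auto
  then show ?case by (simp add: eq mean_linear)
qed

lemma mean_replay: "mean T (\<lambda>m. replay m j x) = (S ^^ j) defect x"
  unfolding replay_def defect_def[abs_def] S_pow_mean ..

lemma replay_le_energy: "m \<in> {1..T} \<Longrightarrow> x \<in> carrier_vec d \<Longrightarrow> replay m j x \<le> energy j x"
  unfolding replay_def by (rule S_pow_mono[OF orth_proj_norm_le[OF E]])

lemma replay_zero: "m \<in> {1..T} \<Longrightarrow> x \<in> carrier_vec d \<Longrightarrow> replay m 0 (P m *\<^sub>v x) = 0"
proof -
  assume m: "m \<in> {1..T}" and x: "x \<in> carrier_vec d"
  note e = ED[OF m]
  have "E m *\<^sub>v (E m *\<^sub>v x) = E m *\<^sub>v x"
    using e(1,2) x by (subst assoc_mult_mat_vec[symmetric, of _ d d _ d]) auto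
  then have "E m *\<^sub>v (P m *\<^sub>v x) = 0\<^sub>v d"
    unfolding P_def complement_mult_vec[OF e(1) x]
    using e(1) x m by (subst mult_minus_distrib_mat_vec[of _ d d]) auto
  then show ?thesis by (simp add: replay_def)
qed

text \<open>The expected residual on task \<open>\<tau> t\<close>, which is also used at step \<open>t\<close>, is compared with the
  trajectory that skips step \<open>t\<close>: for the latter the task is independent of the iterate.\<close>

lemma mean_replay_le:
  assumes x: "x \<in> carrier_vec d"
  shows "mean T (\<lambda>m. replay m (Suc j) (P m *\<^sub>v x)) \<le> 2 * (S ^^ Suc j) defect x + 2 * min 1 \<delta> * defect x"
proof -
  have "replay m (Suc j) (P m *\<^sub>v x) \<le> 2 * replay m (Suc j) x + (2 * min 1 \<delta>) * nsq (E m *\<^sub>v x)"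
    if m: "m \<in> {1..T}" for m
  proof -
    \<comment> \<open>The actual start is that of the skipping trajectory minus E m x. The evolution
      of this difference costs the factor \<open>min 1 \<delta>\<close>.\<close>
    have "P m *\<^sub>v x = x - E m *\<^sub>v x" unfolding P_def using ED(1)[OF m] x by (rule complement_mult_vec)
    moreover have "replay m (Suc j) (E m *\<^sub>v x) \<le> min 1 \<delta> * nsq (E m *\<^sub>v x)"
      using replay_le_energy[OF m, of "E m *\<^sub>v x" "Suc j"] energy_Suc_le[of "E m *\<^sub>v x" j] m x by simp
    ultimately show ?thesis using replay_minus_le[OF m x, of "E m *\<^sub>v x" "Suc j"] m x by simp
  qed
  then have "mean T (\<lambda>m. replay m (Suc j) (P m *\<^sub>v x))
      \<le> mean T (\<lambda>m. 2 * replay m (Suc j) x + (2 * min 1 \<delta>) * nsq (E m *\<^sub>v x))"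
    by (rule mean_mono)
  then show ?thesis by (simp only: mean_linear mean_replay defect_def[symmetric])
qed

text \<open>The skipping trajectory makes t + j + 1 steps, one fewer than the actual one, which
  fixes the index of the first decrement.\<close>

lemma S_pow_mean_replay_le:
  assumes x: "x \<in> carrier_vec d"
  shows "(S ^^ t) (\<lambda>x. mean T (\<lambda>m. replay m (Suc j) (P m *\<^sub>v x))) x
    \<le> 2 * (energy (Suc (t + j)) x - energy (Suc (Suc (t + j))) x)
      + 2 * min 1 \<delta> * (energy t x - energy (Suc t) x)"
proof -
  have "(S ^^ t) (\<lambda>x. mean T (\<lambda>m. replay m (Suc j) (P m *\<^sub>v x))) x
      \<le> (S ^^ t) (\<lambda>x. 2 * (S ^^ Suc j) defect x + (2 * min 1 \<delta>) * defect x) x"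
    using x mean_replay_le by (intro S_pow_mono) auto
  also have "\<dots> = 2 * (S ^^ t) ((S ^^ Suc j) defect) x + (2 * min 1 \<delta>) * (S ^^ t) defect x"
    by (simp only: S_pow_linear)
  also have "(S ^^ t) ((S ^^ Suc j) defect) = (S ^^ (t + Suc j)) defect"
    by (simp only: funpow_add o_apply)
  finally show ?thesis by (simp only: S_pow_defect[OF x] add_Suc_right)
qed

end

section \<open>Random orderings\<close>

lemma set_random_ordering:
  assumes "T \<ge> 1" "\<tau> \<in> set_pmf (random_ordering T k)" "i \<in> {1..k}"
  shows "\<tau> i \<in> {1..T}"
proof -
  have "\<tau> \<in> PiE_dflt {1..k} 0 (set_pmf \<circ> (\<lambda>_. pmf_of_set {1..T}))"
    using assms(2) set_Pi_pmf_subset'[of "{1..k}" 0 "\<lambda>_. pmf_of_set {1..T}"]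
    unfolding random_ordering_def by blast
  then have "\<tau> i \<in> set_pmf (pmf_of_set {1..T})"
    using assms(3) by (auto simp: PiE_dflt_def)
  then show ?thesis using assms(1) by (subst (asm) set_pmf_of_set) auto
qed

text \<open>Finite support makes every real function of the ordering integrable.\<close>

lemma finite_random_ordering:
  assumes "T \<ge> 1"
  shows "finite (set_pmf (random_ordering T k))"
proof (rule finite_subset)
  show "set_pmf (random_ordering T k) \<subseteq> PiE_dflt {1..k} 0 (\<lambda>_. {1..T})"
    using set_Pi_pmf_subset'[of "{1..k}" 0 "\<lambda>_. pmf_of_set {1..T}"] assms
    by (simp add: random_ordering_def o_def set_pmf_of_set)
qed (auto intro: finite_PiE_dflt)

lemma integrable_random_ordering:
  "T \<ge> 1 \<Longrightarrow> integrable (measure_pmf (random_ordering T k)) (f :: _ \<Rightarrow> real)"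
  by (intro integrable_measure_pmf_finite finite_random_ordering)

abbreviation mean_ordering :: "nat \<Rightarrow> nat \<Rightarrow> ((nat \<Rightarrow> nat) \<Rightarrow> real) \<Rightarrow> real" where
  "mean_ordering T k \<equiv> measure_pmf.expectation (random_ordering T k)"

lemma mean_ordering_mono:
  assumes "T \<ge> 1"
    and "\<And>\<tau>. (\<And>i. i \<in> {1..k} \<Longrightarrow> \<tau> i \<in> {1..T}) \<Longrightarrow> f \<tau> \<le> g \<tau>"
  shows "mean_ordering T k f \<le> mean_ordering T k g"
proof (intro integral_mono_AE integrable_random_ordering assms(1))
  have "f \<tau> \<le> g \<tau>" if "\<tau> \<in> set_pmf (random_ordering T k)" for \<tau>
    by (intro assms(2) set_random_ordering[OF assms(1) that])
  then show "AE \<tau> in measure_pmf (random_ordering T k). f \<tau> \<le> g \<tau>"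
    by (simp add: AE_measure_pmf_iff)
qed

lemma mean_ordering_0: "mean_ordering T 0 f = f (\<lambda>_. 0)"
  by (simp add: random_ordering_def)

text \<open>The last task is uniform and independent of the earlier ones, so it can be averaged out
  first.\<close>

lemma mean_ordering_Suc:
  assumes T: "T \<ge> 1"
  shows "mean_ordering T (Suc k) f = mean_ordering T k (\<lambda>\<tau>. mean T (\<lambda>m. f (\<tau>(Suc k := m))))"
proof -
  have "{1..Suc k} = insert (Suc k) {1..k}" by auto
  then have "random_ordering T (Suc k)
      = pmf_of_set {1..T} \<bind> (\<lambda>m. map_pmf (\<lambda>\<tau>. \<tau>(Suc k := m)) (random_ordering T k))"
    by (simp add: random_ordering_def Pi_pmf_insert' map_pmf_def)
  then have "mean_ordering T (Suc k) f
      = (\<Sum>m = 1..T. mean_ordering T k (\<lambda>\<tau>. f (\<tau>(Suc k := m))) / real T)"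
    using T finite_random_ordering[OF T, of k]
    by (simp add: pmf_expectation_bind_pmf_of_set divide_inverse mult.commute)
  also have "\<dots> = mean_ordering T k (\<lambda>\<tau>. mean T (\<lambda>m. f (\<tau>(Suc k := m))))"
    unfolding mean_def sum_divide_distrib[symmetric]
    by (simp add: integrable_random_ordering[OF T] Bochner_Integration.integral_sum)
  finally show ?thesis .
qed

section \<open>Error trajectories under a random ordering\<close>

context orth_proj_family
begin

primrec traj :: "real vec \<Rightarrow> (nat \<Rightarrow> nat) \<Rightarrow> nat \<Rightarrow> real vec" where
  "traj z \<tau> 0 = z"
| "traj z \<tau> (Suc t) = P (\<tau> (Suc t)) *\<^sub>v traj z \<tau> t"

lemma traj_upd: "t < k \<Longrightarrow> traj z (\<tau>(k := m)) t = traj z \<tau> t"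
  by (induction t) auto

lemma traj_carrier:
  "z \<in> carrier_vec d \<Longrightarrow> (\<And>i. i \<in> {1..t} \<Longrightarrow> \<tau> i \<in> {1..T}) \<Longrightarrow> traj z \<tau> t \<in> carrier_vec d"
proof (induction t)
  case (Suc t)
  then have "\<tau> (Suc t) \<in> {1..T}" "traj z \<tau> t \<in> carrier_vec d" by auto
  then show ?case by (simp only: traj.simps P_vec)
qed simp

text \<open>Each of the last j draws, averaged out in turn, applies \<open>S\<close> once. The
  function may depend on the task drawn at time t, which stays a parameter; at t = 0 that task is
  the default value 0.\<close>

lemma mean_ordering_suffix:
  "mean_ordering T (t + j) (\<lambda>\<tau>. q (\<tau> t) (traj z \<tau> (t + j)))
    = mean_ordering T t (\<lambda>\<tau>. (S ^^ j) (q (\<tau> t)) (traj z \<tau> t))"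
proof (induction j arbitrary: q)
  case (Suc j)
  have "mean_ordering T (t + Suc j) (\<lambda>\<tau>. q (\<tau> t) (traj z \<tau> (t + Suc j)))
      = mean_ordering T (t + j) (\<lambda>\<tau>. S (q (\<tau> t)) (traj z \<tau> (t + j)))"
    by (simp add: mean_ordering_Suc[OF T] traj_upd S_def)
  also have "\<dots> = mean_ordering T t (\<lambda>\<tau>. (S ^^ j) (S (q (\<tau> t))) (traj z \<tau> t))"
    by (rule Suc.IH)
  finally show ?case by (simp add: funpow_swap1)
qed simp

lemma mean_ordering_traj: "mean_ordering T k (\<lambda>\<tau>. q (traj z \<tau> k)) = (S ^^ k) q z"
  using mean_ordering_suffix[of 0 k "\<lambda>_. q" z] by (simp add: mean_ordering_0)

text \<open>Three stages: the draws after \<open>Suc t\<close> become \<open>replay\<close>, the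
  draw at \<open>Suc t\<close> becomes a mean over m, and the earlier draws become the power of
  \<open>S\<close>.\<close>

lemma mean_ordering_replay:
  "mean_ordering T (Suc t + j) (\<lambda>\<tau>. nsq (E (\<tau> (Suc t)) *\<^sub>v traj z \<tau> (Suc t + j)))
    = (S ^^ t) (\<lambda>x. mean T (\<lambda>m. replay m j (P m *\<^sub>v x))) z"
proof -
  have "mean_ordering T (Suc t + j) (\<lambda>\<tau>. nsq (E (\<tau> (Suc t)) *\<^sub>v traj z \<tau> (Suc t + j)))
      = mean_ordering T (Suc t) (\<lambda>\<tau>. replay (\<tau> (Suc t)) j (traj z \<tau> (Suc t)))"
    using mean_ordering_suffix[of "Suc t" j "\<lambda>m x. nsq (E m *\<^sub>v x)" z] by (simp only: replay_def)
  also have "\<dots> = mean_ordering T t (\<lambda>\<tau>. mean T (\<lambda>m. replay m j (P m *\<^sub>v traj z \<tau> t)))"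
    by (simp add: mean_ordering_Suc[OF T] traj_upd)
  also have "\<dots> = (S ^^ t) (\<lambda>x. mean T (\<lambda>m. replay m j (P m *\<^sub>v x))) z"
    by (rule mean_ordering_traj[of t "\<lambda>x. mean T (\<lambda>m. replay m j (P m *\<^sub>v x))" z])
  finally show ?thesis .
qed

lemma mean_ordering_replay_le:
  assumes z: "z \<in> carrier_vec d" and t: "t < k"
  shows "mean_ordering T k (\<lambda>\<tau>. nsq (E (\<tau> (Suc t)) *\<^sub>v traj z \<tau> k))
    \<le> 2 * (energy (k - 1) z - energy k z) + 2 * min 1 \<delta> * (energy t z - energy (Suc t) z)"
proof (cases "Suc t = k")
  case True
  \<comment> \<open>The task of the last step has just been fitted exactly, so its residual is
    zero.\<close>
  have "mean_ordering T k (\<lambda>\<tau>. nsq (E (\<tau> (Suc t)) *\<^sub>v traj z \<tau> k))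
      = (S ^^ t) (\<lambda>x. mean T (\<lambda>m. replay m 0 (P m *\<^sub>v x))) z"
    using mean_ordering_replay[of t 0 z] unfolding True[symmetric] by (simp only: add_0_right)
  also have "\<dots> = (S ^^ t) (\<lambda>_. 0) z"
  proof (rule S_pow_cong)
    fix x :: "real vec" assume x: "x \<in> carrier_vec d"
    have "mean T (\<lambda>m. replay m 0 (P m *\<^sub>v x)) = mean T (\<lambda>m. 0)"
      by (intro mean_cong replay_zero x)
    then show "mean T (\<lambda>m. replay m 0 (P m *\<^sub>v x)) = 0" by (simp add: mean_const[OF T])
  qed (rule z)
  also have "\<dots> = 0" by (rule S_pow_zero)
  also have "0 \<le> 2 * (energy (k - 1) z - energy k z) + 2 * min 1 \<delta> * (energy t z - energy (Suc t) z)"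
    using energy_decreasing[OF z, of t] delta_nonneg unfolding True[symmetric]
    by (intro add_nonneg_nonneg mult_nonneg_nonneg) (auto simp del: funpow.simps(2))
  finally show ?thesis .
next
  case False
  \<comment> \<open>At least one step follows step \<open>Suc t\<close>, as the comparison with the
    skipping trajectory requires.\<close>
  then obtain j where k: "k = Suc t + Suc j"
    using t by (metis Suc_lessI less_imp_add_positive add_Suc_shift gr0_conv_Suc)
  have *: "k - 1 = Suc (t + j)" "k = Suc (Suc (t + j))" using k by auto
  have "mean_ordering T k (\<lambda>\<tau>. nsq (E (\<tau> (Suc t)) *\<^sub>v traj z \<tau> k))
      = (S ^^ t) (\<lambda>x. mean T (\<lambda>m. replay m (Suc j) (P m *\<^sub>v x))) z"
    unfolding k by (rule mean_ordering_replay)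
  also have "\<dots> \<le> 2 * (energy (Suc (t + j)) z - energy (Suc (Suc (t + j))) z)
      + 2 * min 1 \<delta> * (energy t z - energy (Suc t) z)"
    by (rule S_pow_mean_replay_le[OF z])
  finally show ?thesis unfolding *(1) by (simp only: *(2))
qed

text \<open>The first decrement does not depend on t and is counted k times; the second one
  telescopes over t.\<close>

lemma sum_mean_ordering_replay_le:
  assumes z: "z \<in> carrier_vec d"
  shows "(\<Sum>t = 1..k. mean_ordering T k (\<lambda>\<tau>. nsq (E (\<tau> t) *\<^sub>v traj z \<tau> k)))
    \<le> 2 * real k * (energy (k - 1) z - energy k z) + 2 * (min 1 \<delta> * (nsq z - energy k z))"
proof -
  have "(\<Sum>t = 1..k. mean_ordering T k (\<lambda>\<tau>. nsq (E (\<tau> t) *\<^sub>v traj z \<tau> k)))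
      = (\<Sum>t<k. mean_ordering T k (\<lambda>\<tau>. nsq (E (\<tau> (Suc t)) *\<^sub>v traj z \<tau> k)))"
    using sum.atLeast_Suc_atMost_Suc_shift[of _ 0 "k - 1"]
    by (intro sum.reindex_bij_witness[of _ Suc "\<lambda>t. t - 1"]) auto
  also have "\<dots> \<le> (\<Sum>t<k. 2 * (energy (k - 1) z - energy k z) + 2 * min 1 \<delta> * (energy t z - energy (Suc t) z))"
    by (intro sum_mono mean_ordering_replay_le z) simp
  also have "\<dots> = real k * (2 * (energy (k - 1) z - energy k z)) + 2 * min 1 \<delta> * (\<Sum>t<k. energy t z - energy (Suc t) z)"
    by (simp only: sum.distrib sum_constant card_lessThan sum_distrib_left[symmetric])
  also have "(\<Sum>t<k. energy t z - energy (Suc t) z) = nsq z - energy k z"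
    by (subst sum_lessThan_telescope') simp
  finally show ?thesis by (simp only: mult_ac)
qed

text \<open>If the traces sum to at least 1, then \<open>min 1 \<delta>\<close> is at most both
  \<surd>\<delta> and 1, hence at most \<open>rate\<close>. Otherwise integrality forces every
  trace, hence every \<open>E m\<close>, to act as zero, and no energy is ever lost.\<close>

lemma total_decrement_le:
  assumes nat: "\<And>m. m \<in> {1..T} \<Longrightarrow> mtrace (E m) \<in> \<nat>" and z: "z \<in> carrier_vec d"
  shows "min 1 \<delta> * (nsq z - energy k z) \<le> nsq z * rate"
proof (cases "(\<Sum>m = 1..T. mtrace (E m)) \<ge> 1")
  case True
  have "min 1 \<delta> \<le> sqrt \<delta>"
  proof (cases "\<delta> \<ge> 1")
    case False
    then have "\<delta> * \<delta> \<le> \<delta> * 1" using delta_nonneg by (intro mult_left_mono) auto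
    then have "sqrt (\<delta> * \<delta>) \<le> sqrt \<delta>" by (intro real_sqrt_le_mono) simp
    then show ?thesis using delta_nonneg by simp
  qed (simp add: min_def)
  then have "min 1 \<delta> \<le> rate" using True by (simp add: rate_def min.coboundedI1)
  then have "min 1 \<delta> * (nsq z - energy k z) \<le> rate * nsq z"
    using energy_nonneg[OF z, of k] energy_le[OF z, of k] rate_nonneg by (intro mult_mono) auto
  then show ?thesis by (simp only: mult.commute)
next
  case False
  have "mtrace (E m) = 0" if m: "m \<in> {1..T}" for m
  proof -
    have "mtrace (E m) \<le> (\<Sum>m = 1..T. mtrace (E m))"
      using m orth_proj_mtrace_nonneg[OF E] by (intro member_le_sum) auto
    with False have "mtrace (E m) < 1" by simp
    with nat[OF m] show ?thesis by (auto elim!: Nats_cases)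
  qed
  then have "nsq (E m *\<^sub>v x) \<le> 0" if "m \<in> {1..T}" "x \<in> carrier_vec d" for m x
    using orth_proj_norm_le_mtrace[OF E[OF that(1)] that(2)] that by simp
  then have "defect x \<le> 0" if "x \<in> carrier_vec d" for x
    unfolding defect_def using mean_mono[of T "\<lambda>m. nsq (E m *\<^sub>v x)" "\<lambda>_. 0"] that
    by (simp add: mean_const[OF T])
  then have "(S ^^ n) defect z \<le> (S ^^ n) (\<lambda>_. 0) z" for n
    using z by (rule S_pow_mono)
  then have step: "energy n z \<le> energy (Suc n) z" for n
    unfolding S_pow_zero S_pow_defect[OF z] by (simp del: funpow.simps(2))
  have "nsq z \<le> energy k z"
  proof (induction k)
    case (Suc k)
    then show ?case using step[of k] by linarith
  qed simp
  then have eq: "nsq z - energy k z = 0" using energy_le[OF z, of k] by simp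
  show ?thesis unfolding eq by (simp add: rate_nonneg scalar_prod_self_nonneg)
qed

lemma mean_defect_bound:
  assumes "z \<in> carrier_vec d" "k \<ge> 2"
  shows "mean_ordering T k (\<lambda>\<tau>. defect (traj z \<tau> k)) \<le> nsq z * rate / (exp 1 * (real k - 1))"
  using energy_decrement[OF assms] by (simp only: mean_ordering_traj[of k defect z] S_pow_defect[OF assms(1)])

lemma mean_replay_bound:
  assumes nat: "\<And>m. m \<in> {1..T} \<Longrightarrow> mtrace (E m) \<in> \<nat>" and z: "z \<in> carrier_vec d" and k: "k \<ge> 3"
  shows "(\<Sum>t = 1..k. mean_ordering T k (\<lambda>\<tau>. nsq (E (\<tau> t) *\<^sub>v traj z \<tau> k))) / real k
    \<le> 3 * (nsq z * rate) / (real k - 2)"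
proof -
  let ?c = "nsq z * rate"
  have c: "0 \<le> ?c" by (intro mult_nonneg_nonneg scalar_prod_self_nonneg rate_nonneg)
  \<comment> \<open>The decrement starts at k - 1, and the rate at index n has n - 1 below: hence k
    - 2, and k \<ge> 3 to make the index at least 2.\<close>
  have "energy (k - 1) z - energy (Suc (k - 1)) z \<le> ?c / (exp 1 * (real (k - 1) - 1))"
    using z k by (intro energy_decrement) auto
  also have "\<dots> = ?c / (exp 1 * (real k - 2))" using k by (simp add: of_nat_diff)
  \<comment> \<open>With e weakened to 2, this decrement contributes 1 to the final constant and the
    telescoped term contributes 2.\<close>
  also have "\<dots> \<le> ?c / (2 * (real k - 2))"
    using k c exp_ge_add_one_self[of "1 :: real"] by (intro divide_left_mono mult_right_mono) auto
  finally have 1: "energy (k - 1) z - energy k z \<le> ?c / (2 * (real k - 2))" using k by simp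
  have "(\<Sum>t = 1..k. mean_ordering T k (\<lambda>\<tau>. nsq (E (\<tau> t) *\<^sub>v traj z \<tau> k)))
      \<le> 2 * real k * (?c / (2 * (real k - 2))) + 2 * ?c"
    using 1 total_decrement_le[OF nat z, of k]
    by (intro order_trans[OF sum_mean_ordering_replay_le[OF z]] add_mono mult_left_mono) auto
  then have "(\<Sum>t = 1..k. mean_ordering T k (\<lambda>\<tau>. nsq (E (\<tau> t) *\<^sub>v traj z \<tau> k))) / real k
      \<le> (2 * real k * (?c / (2 * (real k - 2))) + 2 * ?c) / real k"
    by (intro divide_right_mono) auto
  also have "\<dots> = ?c / (real k - 2) + 2 * ?c / real k" using k by (simp add: field_simps)
  also have "\<dots> \<le> ?c / (real k - 2) + 2 * ?c / (real k - 2)"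
    using k c by (intro add_left_mono divide_left_mono) auto
  also have "\<dots> = 3 * ?c / (real k - 2)" by (simp add: add_divide_distrib[symmetric])
  finally show ?thesis .
qed

end

section \<open>Continual regression\<close>

lemma vnorm_square: "(vnorm v)\<^sup>2 = nsq v"
  by (simp add: vnorm_def scalar_prod_self_nonneg)

lemma vnorm_nonneg: "0 \<le> vnorm v"
  by (simp add: vnorm_def scalar_prod_self_nonneg)

lemma vnorm_smult: "vnorm (a \<cdot>\<^sub>v v) = \<bar>a\<bar> * vnorm v"
proof -
  have "nsq (a \<cdot>\<^sub>v v) = a\<^sup>2 * nsq v"
    by (simp add: scalar_prod_def sum_distrib_left power2_eq_square mult_ac)
  then show ?thesis by (simp add: vnorm_def real_sqrt_mult)
qed

lemma vnorm_mult_le_spectral_norm: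
  assumes A: "A \<in> carrier_mat n p" and v: "v \<in> carrier_vec p"
  shows "vnorm (A *\<^sub>v v) \<le> spectral_norm A * vnorm v"
proof (cases "vnorm v = 0")
  case True
  then have "v = 0\<^sub>v p" using v by (simp add: vnorm_def scalar_prod_self_eq_0)
  then have "A *\<^sub>v v = 0\<^sub>v n" using A by auto
  then show ?thesis using True by (simp add: vnorm_def)
next
  case False
  then have pos: "vnorm v > 0" using vnorm_nonneg[of v] by simp
  let ?B = "{v \<in> carrier_vec (dim_col A). vnorm v \<le> 1}"
  \<comment> \<open>A real supremum dominates its members only if the set is bounded; the Frobenius
    norm provides a bound.\<close>
  have "bdd_above ((\<lambda>v. vnorm (A *\<^sub>v v)) ` ?B)"
  proof (intro bdd_aboveI2)
    fix x assume x: "x \<in> ?B"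
    then have "(vnorm x)\<^sup>2 \<le> 1" using vnorm_nonneg[of x] by (simp add: power_le_one)
    then have "mtrace (A\<^sup>T * A) * nsq x \<le> mtrace (A\<^sup>T * A) * 1"
      unfolding vnorm_square by (intro mult_left_mono mtrace_gram_nonneg)
    moreover have "nsq (A *\<^sub>v x) \<le> mtrace (A\<^sup>T * A) * nsq x"
      using x A by (intro norm_mult_mat_vec_le) auto
    ultimately have "nsq (A *\<^sub>v x) \<le> mtrace (A\<^sup>T * A)" by linarith
    then show "vnorm (A *\<^sub>v x) \<le> sqrt (mtrace (A\<^sup>T * A))"
      unfolding vnorm_def by (intro real_sqrt_le_mono) simp
  qed
  moreover have "(1 / vnorm v) \<cdot>\<^sub>v v \<in> ?B"
    using A v pos by (simp add: vnorm_smult)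
  ultimately have "vnorm (A *\<^sub>v ((1 / vnorm v) \<cdot>\<^sub>v v)) \<le> spectral_norm A"
    unfolding spectral_norm_def by (rule cSUP_upper2) simp
  also have "A *\<^sub>v ((1 / vnorm v) \<cdot>\<^sub>v v) = (1 / vnorm v) \<cdot>\<^sub>v (A *\<^sub>v v)"
    using A v by (rule mult_mat_vec)
  finally show ?thesis using pos by (simp add: vnorm_smult field_simps)
qed

lemma spectral_norm_le_data_radius: "m \<in> {1..T} \<Longrightarrow> spectral_norm (X m) \<le> data_radius T X"
  by (simp add: data_radius_def)

section \<open>Regression tasks as a family of projections\<close>

locale continual_regression =
  fixes d T :: nat and n :: "nat \<Rightarrow> nat" and X :: "nat \<Rightarrow> real mat" and y :: "nat \<Rightarrow> real vec"
  assumes T_pos: "T \<ge> 1"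
    and X: "\<And>m. m \<in> {1..T} \<Longrightarrow> X m \<in> carrier_mat (n m) d"
    and realizable: "joint_solutions d T X y \<noteq> {}"
begin

abbreviation "E \<equiv> \<lambda>m. pseudo_inverse (X m) * X m"

sublocale orth_proj_family d T E
  using T_pos orth_proj_pseudo_inverse(1)[OF X] by unfold_locales

lemma pinv_carrier: "m \<in> {1..T} \<Longrightarrow> pseudo_inverse (X m) \<in> carrier_mat d (n m)"
  using pseudo_inverse(1)[OF X, of m] X[of m] by (auto simp: is_pseudo_inverse_def)

lemma X_mult_E:
  assumes m: "m \<in> {1..T}" and v: "v \<in> carrier_vec d"
  shows "X m *\<^sub>v (E m *\<^sub>v v) = X m *\<^sub>v v"
proof -
  have "X m *\<^sub>v (E m *\<^sub>v v) = (X m * E m) *\<^sub>v v"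
    using X[OF m] ED(1)[OF m] v by (rule assoc_mult_mat_vec[symmetric])
  then show ?thesis by (simp only: orth_proj_pseudo_inverse(2)[OF X[OF m]])
qed

text \<open>X v = X X^+ X v, so only the component E v contributes to the residual.\<close>

lemma residual_le:
  assumes m: "m \<in> {1..T}" and v: "v \<in> carrier_vec d"
  shows "nsq (X m *\<^sub>v v) \<le> (data_radius T X)\<^sup>2 * nsq (E m *\<^sub>v v)"
proof -
  have "vnorm (X m *\<^sub>v v) \<le> spectral_norm (X m) * vnorm (E m *\<^sub>v v)"
    using vnorm_mult_le_spectral_norm[OF X[OF m] E_vec[OF m v]] by (simp only: X_mult_E[OF m v])
  also have "\<dots> \<le> data_radius T X * vnorm (E m *\<^sub>v v)"
    by (intro mult_right_mono spectral_norm_le_data_radius m vnorm_nonneg)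
  finally have "(vnorm (X m *\<^sub>v v))\<^sup>2 \<le> (data_radius T X * vnorm (E m *\<^sub>v v))\<^sup>2"
    by (intro power_mono vnorm_nonneg)
  then show ?thesis by (simp only: power_mult_distrib vnorm_square)
qed

text \<open>\<open>arg_min_on\<close> is a choice operator, so a minimum has to be exhibited. For
  any solution w, the projection F w onto the sum of the row spaces is still a solution; all
  solutions share this projection, and projecting does not increase the norm.\<close>

lemma min_norm_solution_mem: "min_norm_solution d T X y \<in> joint_solutions d T X y"
proof -
  obtain F where F: "orth_proj d F" "\<And>m. m \<in> {1..T} \<Longrightarrow> E m * F = E m"
    "\<And>v. v \<in> carrier_vec d \<Longrightarrow> (\<And>m. m \<in> {1..T} \<Longrightarrow> E m *\<^sub>v v = 0\<^sub>v d) \<Longrightarrow> F *\<^sub>v v = 0\<^sub>v d"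
    by (rule orth_proj_join[of T d E]) (use local.E in blast)+
  note F' = orth_projD[OF F(1)]
  obtain w where w: "w \<in> carrier_vec d" "\<And>m. m \<in> {1..T} \<Longrightarrow> X m *\<^sub>v w = y m"
    using realizable by (auto simp: joint_solutions_def)
  have Fw: "F *\<^sub>v w \<in> carrier_vec d" using F' w by auto
  have "X m *\<^sub>v (F *\<^sub>v w) = y m" if m: "m \<in> {1..T}" for m
  proof -
    have "E m *\<^sub>v (F *\<^sub>v w) = (E m * F) *\<^sub>v w"
      using ED(1)[OF m] F'(1) w(1) by (rule assoc_mult_mat_vec[symmetric])
    then show ?thesis using X_mult_E[OF m Fw] X_mult_E[OF m w(1)] w(2)[OF m] by (simp only: F(2)[OF m])
  qed
  then have sol: "F *\<^sub>v w \<in> joint_solutions d T X y" using Fw by (simp add: joint_solutions_def)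
  have min: "vnorm (F *\<^sub>v w) \<le> vnorm u" if u: "u \<in> joint_solutions d T X y" for u
  proof -
    have u: "u \<in> carrier_vec d" "\<And>m. m \<in> {1..T} \<Longrightarrow> X m *\<^sub>v u = y m"
      using u by (auto simp: joint_solutions_def)
    have "E m *\<^sub>v (w - u) = 0\<^sub>v d" if m: "m \<in> {1..T}" for m
    proof -
      have "E m *\<^sub>v v = pseudo_inverse (X m) *\<^sub>v (X m *\<^sub>v v)" if "v \<in> carrier_vec d" for v
        using pinv_carrier[OF m] X[OF m] that by (rule assoc_mult_mat_vec)
      then have "E m *\<^sub>v w = E m *\<^sub>v u" using w(2)[OF m] u(2)[OF m] w(1) u(1) by simp
      then show ?thesis
        using mult_minus_distrib_mat_vec[OF ED(1)[OF m] w(1) u(1)] E_vec[OF m u(1)] by simp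
    qed
    then have "F *\<^sub>v (w - u) = 0\<^sub>v d" using w(1) u(1) by (intro F(3)) auto
    moreover have "F *\<^sub>v (w - u) = F *\<^sub>v w - F *\<^sub>v u"
      using F'(1) w(1) u(1) by (rule mult_minus_distrib_mat_vec)
    ultimately have 0: "F *\<^sub>v w - F *\<^sub>v u = 0\<^sub>v d" by simp
    have "(F *\<^sub>v w) $ i = (F *\<^sub>v u) $ i" if i: "i < d" for i
      using arg_cong[OF 0, of "\<lambda>v. v $ i"] i F' by simp
    then have "F *\<^sub>v w = F *\<^sub>v u" using F' by (intro eq_vecI) auto
    then show ?thesis
      unfolding vnorm_def using orth_proj_norm_le[OF F(1) u(1)] by simp
  qed
  show ?thesis unfolding min_norm_solution_def arg_min_on_def
    by (rule arg_minI[of _ "F *\<^sub>v w"]) (use sol min in \<open>auto simp: not_less\<close>)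
qed

abbreviation "w_min \<equiv> min_norm_solution d T X y"
abbreviation "z0 \<equiv> 0\<^sub>v d - w_min"

lemma w_min: "w_min \<in> carrier_vec d" "\<And>m. m \<in> {1..T} \<Longrightarrow> X m *\<^sub>v w_min = y m"
  using min_norm_solution_mem by (auto simp: joint_solutions_def)

lemma z0_carrier: "z0 \<in> carrier_vec d"
  using w_min(1) by simp

lemma nsq_z0: "nsq z0 = (vnorm w_min)\<^sup>2"
proof -
  have "z0 = - w_min" using w_min(1) by (intro eq_vecI) auto
  then show ?thesis by (simp add: vnorm_square)
qed

lemma residual_eq:
  assumes m: "m \<in> {1..T}" and w: "w \<in> carrier_vec d"
  shows "X m *\<^sub>v w - y m = X m *\<^sub>v (w - w_min)"
  using mult_minus_distrib_mat_vec[OF X[OF m] w w_min(1)] w_min(2)[OF m] by simp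

text \<open>As \<open>y m\<close> is X m applied to \<open>w_min\<close>, a block Kaczmarz step
  subtracts E m times the current error, that is, applies \<open>P m\<close> to it.\<close>

lemma iterate_eq_traj:
  assumes "\<And>i. i \<in> {1..t} \<Longrightarrow> \<tau> i \<in> {1..T}"
  shows "iterate d X y \<tau> t \<in> carrier_vec d \<and> iterate d X y \<tau> t - w_min = traj z0 \<tau> t"
  using assms
proof (induction t)
  case (Suc t)
  define w where "w = iterate d X y \<tau> t"
  have w: "w \<in> carrier_vec d" "w - w_min = traj z0 \<tau> t"
    using Suc by (auto simp: w_def)
  define m where "m = \<tau> (Suc t)"
  have m: "m \<in> {1..T}" unfolding m_def by (rule Suc.prems) simp
  have wm: "w - w_min \<in> carrier_vec d" using w(1) w_min(1) by simp
  have "pseudo_inverse (X m) *\<^sub>v (X m *\<^sub>v w - y m) = E m *\<^sub>v (w - w_min)"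
    unfolding residual_eq[OF m w(1)]
    using pinv_carrier[OF m] X[OF m] wm by (rule assoc_mult_mat_vec[symmetric])
  then have it: "iterate d X y \<tau> (Suc t) = w - E m *\<^sub>v (w - w_min)"
    by (simp add: Let_def w_def m_def)
  have Ew: "E m *\<^sub>v (w - w_min) \<in> carrier_vec d" by (rule E_vec[OF m wm])
  have "P m *\<^sub>v (w - w_min) = (w - w_min) - E m *\<^sub>v (w - w_min)"
    unfolding P_def by (rule complement_mult_vec[OF ED(1)[OF m] wm])
  also have "\<dots> = (w - E m *\<^sub>v (w - w_min)) - w_min"
  proof -
    have "(w - w_min) - e = (w - e) - w_min" if "e \<in> carrier_vec d" for e
      using w(1) w_min(1) that by (intro eq_vecI) auto
    then show ?thesis using Ew .
  qed
  finally show ?case using w(1) Ew unfolding it traj.simps m_def[symmetric] w(2)[symmetric] by simp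
qed (use w_min in simp)

lemma residual_iterate_le:
  assumes "\<And>i. i \<in> {1..t} \<Longrightarrow> \<tau> i \<in> {1..T}" "m \<in> {1..T}"
  shows "(vnorm (X m *\<^sub>v iterate d X y \<tau> t - y m))\<^sup>2 \<le> (data_radius T X)\<^sup>2 * nsq (E m *\<^sub>v traj z0 \<tau> t)"
proof -
  have it: "iterate d X y \<tau> t \<in> carrier_vec d" "iterate d X y \<tau> t - w_min = traj z0 \<tau> t"
    using iterate_eq_traj[OF assms(1)] by auto
  show ?thesis unfolding vnorm_square residual_eq[OF assms(2) it(1)] it(2)
    using assms z0_carrier by (intro residual_le traj_carrier)
qed

lemma training_loss_iterate_le:
  assumes "\<And>i. i \<in> {1..t} \<Longrightarrow> \<tau> i \<in> {1..T}"
  shows "training_loss T X y (iterate d X y \<tau> t) \<le> (data_radius T X)\<^sup>2 / 2 * defect (traj z0 \<tau> t)"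
proof -
  have "training_loss T X y (iterate d X y \<tau> t)
      \<le> (\<Sum>m = 1..T. (data_radius T X)\<^sup>2 * nsq (E m *\<^sub>v traj z0 \<tau> t)) / (2 * real T)"
    unfolding training_loss_def by (intro divide_right_mono sum_mono residual_iterate_le assms) auto
  also have "\<dots> = (data_radius T X)\<^sup>2 / 2 * defect (traj z0 \<tau> t)"
    by (simp add: defect_def mean_def sum_distrib_left[symmetric])
  finally show ?thesis .
qed

lemma forgetting_le:
  assumes "\<And>i. i \<in> {1..k} \<Longrightarrow> \<tau> i \<in> {1..T}"
  shows "forgetting d X y \<tau> k
    \<le> (data_radius T X)\<^sup>2 / (2 * real k) * (\<Sum>t = 1..k. nsq (E (\<tau> t) *\<^sub>v traj z0 \<tau> k))"
proof -
  have "forgetting d X y \<tau> k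
      \<le> (\<Sum>t = 1..k. (data_radius T X)\<^sup>2 * nsq (E (\<tau> t) *\<^sub>v traj z0 \<tau> k)) / (2 * real k)"
    unfolding forgetting_def by (intro divide_right_mono sum_mono residual_iterate_le assms) auto
  also have "\<dots> = (data_radius T X)\<^sup>2 / (2 * real k) * (\<Sum>t = 1..k. nsq (E (\<tau> t) *\<^sub>v traj z0 \<tau> k))"
    by (simp add: sum_distrib_left[symmetric])
  finally show ?thesis .
qed

section \<open>Ranks as traces and the two bounds\<close>

lemma mtrace_E: "m \<in> {1..T} \<Longrightarrow> mtrace (E m) = real (vec_space.rank (dim_row (X m)) (X m))"
  using pseudo_inverse(2)[OF X[of m]] X[of m] by auto

lemma sum_mtrace_E: "(\<Sum>m = 1..T. mtrace (E m)) = real T * avg_rank T X"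
  using T_pos by (simp add: avg_rank_def mtrace_E)

lemma delta_eq: "\<delta> = real d - avg_rank T X"
proof -
  have "\<delta> = mean T (\<lambda>m. 1 * real d + (-1) * mtrace (E m))"
    unfolding \<delta>_def P_def by (intro mean_cong) (simp add: mtrace_minus[OF one_carrier_mat ED(1)] mtrace_one)
  also have "\<dots> = real d - mean T (\<lambda>m. mtrace (E m))"
    by (simp only: mean_linear mean_const[OF T_pos])
  finally show ?thesis using T_pos unfolding mean_def sum_mtrace_E by simp
qed

lemma rate_eq: "rate = min (sqrt (real d - avg_rank T X)) (sqrt (real T * avg_rank T X))"
  by (simp only: rate_def delta_eq sum_mtrace_E)

lemma mean_training_loss_le:
  assumes "k \<ge> 2"
  shows "mean_ordering T k (\<lambda>\<tau>. training_loss T X y (iterate d X y \<tau> k))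
    \<le> rate * (vnorm w_min)\<^sup>2 * (data_radius T X)\<^sup>2 / (2 * exp 1 * (real k - 1))"
proof -
  let ?c = "(data_radius T X)\<^sup>2 / 2"
  have "mean_ordering T k (\<lambda>\<tau>. training_loss T X y (iterate d X y \<tau> k))
      \<le> mean_ordering T k (\<lambda>\<tau>. ?c * defect (traj z0 \<tau> k))"
    by (intro mean_ordering_mono T_pos training_loss_iterate_le)
  also have "\<dots> = ?c * mean_ordering T k (\<lambda>\<tau>. defect (traj z0 \<tau> k))" by simp
  also have "\<dots> \<le> ?c * (nsq z0 * rate / (exp 1 * (real k - 1)))"
    using assms by (intro mult_left_mono mean_defect_bound z0_carrier) auto
  finally show ?thesis by (simp add: nsq_z0 mult_ac)
qed

lemma mean_forgetting_le:
  assumes k: "k \<ge> 3"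
  shows "mean_ordering T k (\<lambda>\<tau>. forgetting d X y \<tau> k)
    \<le> 3 * rate * (vnorm w_min)\<^sup>2 * (data_radius T X)\<^sup>2 / (2 * (real k - 2))"
proof -
  let ?R = "(data_radius T X)\<^sup>2"
  let ?s = "\<lambda>\<tau> t. nsq (E (\<tau> t) *\<^sub>v traj z0 \<tau> k)"
  have "mean_ordering T k (\<lambda>\<tau>. forgetting d X y \<tau> k)
      \<le> mean_ordering T k (\<lambda>\<tau>. ?R / (2 * real k) * (\<Sum>t = 1..k. ?s \<tau> t))"
    by (intro mean_ordering_mono T_pos forgetting_le)
  also have "\<dots> = ?R / (2 * real k) * (\<Sum>t = 1..k. mean_ordering T k (\<lambda>\<tau>. ?s \<tau> t))"
    by (simp add: integrable_random_ordering[OF T_pos] Bochner_Integration.integral_sum)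
  also have "\<dots> = ?R / 2 * ((\<Sum>t = 1..k. mean_ordering T k (\<lambda>\<tau>. ?s \<tau> t)) / real k)" by simp
  also have "\<dots> \<le> ?R / 2 * (3 * (nsq z0 * rate) / (real k - 2))"
    using k mtrace_E by (intro mult_left_mono mean_replay_bound z0_carrier) auto
  finally show ?thesis by (simp add: nsq_z0 mult_ac)
qed

end

theorem theorem8:
  fixes d T k :: nat
    and n :: "nat \<Rightarrow> nat"
    and X :: "nat \<Rightarrow> real mat"
    and y :: "nat \<Rightarrow> real vec"
    and w_star :: "real vec"
    and R r_bar :: real
  assumes "T \<ge> 1"
    and "\<And>m. m \<in> {1..T} \<Longrightarrow> X m \<in> carrier_mat (n m) d"
    and "\<And>m. m \<in> {1..T} \<Longrightarrow> y m \<in> carrier_vec (n m)"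
    and "joint_solutions d T X y \<noteq> {}"
    and "w_star = min_norm_solution d T X y"
    and "R = data_radius T X"
    and "r_bar = avg_rank T X"
    and "k \<ge> 3"
  shows "measure_pmf.expectation (random_ordering T k)
           (\<lambda>\<tau>. training_loss T X y (iterate d X y \<tau> k))
         \<le> min (sqrt (real d - r_bar)) (sqrt (real T * r_bar)) * (vnorm w_star)\<^sup>2 * R\<^sup>2
             / (2 * exp 1 * (real k - 1))
       \<and> measure_pmf.expectation (random_ordering T k)
           (\<lambda>\<tau>. forgetting d X y \<tau> k)
         \<le> 3 * min (sqrt (real d - r_bar)) (sqrt (real T * r_bar)) * (vnorm w_star)\<^sup>2 * R\<^sup>2
             / (2 * (real k - 2))"
proof -
  interpret continual_regression d T n X y
    using assms(1,2,4) by unfold_locales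
  show ?thesis
    using mean_training_loss_le[of k] mean_forgetting_le[of k] assms(8)
    unfolding assms(5,6,7) rate_eq by simp
qed

end
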